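(* Let $s\ge2$ and $d\ge1$ be integers, and let $f(\pmb{x})=\sum_{s_1+\dots+s_d=s,\ s_i\in\mathbb{Z}_{\ge0}} f_{s_1,\dots,s_d}x_1^{s_1}\cdots x_d^{s_d}$ be a homogeneous polynomial of degree $s$ in $d$ variables with rational coefficients $f_{s_1,\dots,s_d}\in\mathbb{Q}$, such that the set $\{\pmb{x}\in\mathbb{Q}^d: f(\pmb{x})=0\}$ is finite. Let $\xi_1,\dots,\xi_d\in\mathbb{R}$ and suppose that $\Xi_f=(\xi_1,\dots,\xi_d,f(\xi_1,\dots,\xi_d))\in\mathbb{R}^{d+1}$ is totally irrational (i.e. $1,\xi_1,\dots,\xi_d,f(\xi_1,\dots,\xi_d)$ are linearly independent over $\mathbb{Z}$). Then $\hat{\omega}(\Xi_f)\le H_{d,s}$.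
   Context: For $\Theta=(\theta_1,\dots,\theta_m)\in\mathbb{R}^m$, the uniform Diophantine exponent $\hat{\omega}(\Theta)$ is the supremum of all real $\gamma$ such that for every sufficiently large real $Q$ the system $\max_{1\le j\le m}|q\theta_j-a_j|<Q^{-\gamma}$, $1\le q\le Q$, has a solution $(q,a_1,\dots,a_m)\in\mathbb{Z}^{m+1}$. For integers $s\ge2$, $d\ge1$, $H_{d,s}$ denotes the unique positive root of $1-x=x\sum_{k=1}^{d}\left(\frac{x}{s-1}\right)^k$. *)

theory Defs
  imports Complex_Main "HOL-Library.Extended_Real" "HOL-Library.FuncSet"
begin

text \<open>A point of \<open>K\<^sup>m\<close> is a function on \<open>nat\<close> of which only the values at the indices
  \<open>0, \<dots>, m - 1\<close> matter. Where points have to be counted, or summed over, they are taken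
  extensional, \<open>{..<m} \<rightarrow>\<^sub>E UNIV\<close>, so that every point has exactly one representative.\<close>

definition uniform_system_solvable :: "nat \<Rightarrow> (nat \<Rightarrow> real) \<Rightarrow> real \<Rightarrow> real \<Rightarrow> bool" where
  "uniform_system_solvable m \<theta> \<gamma> Q \<longleftrightarrow>
     (\<exists>(q::int) (a::nat \<Rightarrow> int). 1 \<le> q \<and> real_of_int q \<le> Q \<and>
        (MAX j\<in>{..<m}. \<bar>real_of_int q * \<theta> j - real_of_int (a j)\<bar>) < Q powr (- \<gamma>))"

text \<open>The supremum is extended real, since the set of admissible \<open>\<gamma>\<close> may be unbounded
  (e.g. for rational \<open>\<theta>\<close>). Meaningful for \<open>m \<ge> 1\<close> only.\<close>

definition uniform_exponent :: "nat \<Rightarrow> (nat \<Rightarrow> real) \<Rightarrow> ereal" where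
  "uniform_exponent m \<theta> =
     Sup (ereal ` {\<gamma>. eventually (uniform_system_solvable m \<theta> \<gamma>) at_top})"

definition totally_irrational :: "nat \<Rightarrow> (nat \<Rightarrow> real) \<Rightarrow> bool" where
  "totally_irrational m \<theta> \<longleftrightarrow>
     (\<forall>(b::int) (a::nat \<Rightarrow> int).
        real_of_int b + (\<Sum>j<m. real_of_int (a j) * \<theta> j) = 0 \<longrightarrow> b = 0 \<and> (\<forall>j<m. a j = 0))"

definition multi_indices :: "nat \<Rightarrow> nat \<Rightarrow> (nat \<Rightarrow> nat) set" where
  "multi_indices d s = {e \<in> {..<d} \<rightarrow>\<^sub>E UNIV. (\<Sum>i<d. e i) = s}"

text \<open>A form of degree \<open>s\<close> in \<open>d\<close> variables with rational coefficients is given by its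
  coefficient family \<open>c\<close>, indexed by \<open>multi_indices d s\<close>. The evaluation is generic, so
  that the same form can be evaluated at rational and at real points.\<close>

definition form_eval ::
    "nat \<Rightarrow> nat \<Rightarrow> ((nat \<Rightarrow> nat) \<Rightarrow> rat) \<Rightarrow> (nat \<Rightarrow> 'a::field_char_0) \<Rightarrow> 'a" where
  "form_eval d s c x = (\<Sum>e\<in>multi_indices d s. of_rat (c e) * (\<Prod>i<d. x i ^ e i))"

definition H_root :: "nat \<Rightarrow> nat \<Rightarrow> real" where
  "H_root d s =
     (THE x. 0 < x \<and> 1 - x = x * (\<Sum>k=1..d. (x / (real s - 1)) ^ k))"

text \<open>The sum over \<open>multi_indices\<close> ranges over a finite set, and the description of
  \<open>H_root\<close> is uniquely satisfied.\<close>

lemma finite_multi_indices: "finite (multi_indices d s)"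
proof (rule finite_subset)
  show "multi_indices d s \<subseteq> {..<d} \<rightarrow>\<^sub>E {..s}"
  proof
    fix e assume "e \<in> multi_indices d s"
    then have e: "e \<in> {..<d} \<rightarrow>\<^sub>E UNIV" and s: "(\<Sum>i<d. e i) = s"
      by (auto simp: multi_indices_def)
    have "e i \<le> s" if "i < d" for i
      using member_le_sum[of i "{..<d}" e] that s by auto
    with e show "e \<in> {..<d} \<rightarrow>\<^sub>E {..s}"
      by (auto simp: PiE_def)
  qed
  show "finite ({..<d} \<rightarrow>\<^sub>E {..s})"
    by (intro finite_PiE) auto
qed

lemma H_root_unique:
  fixes d s :: nat
  assumes "s \<ge> 2"
  shows "\<exists>!x::real. 0 < x \<and> 1 - x = x * (\<Sum>k=1..d. (x / (real s - 1)) ^ k)"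
proof -
  define g where "g = (\<lambda>x::real. x + x * (\<Sum>k=1..d. (x / (real s - 1)) ^ k))"
  have s: "real s - 1 > 0" using assms by simp
  have mono: "g x < g y" if "0 < x" "x < y" for x y
  proof -
    have "(\<Sum>k=1..d. (x / (real s - 1)) ^ k) \<le> (\<Sum>k=1..d. (y / (real s - 1)) ^ k)"
      using that s by (intro sum_mono power_mono divide_right_mono) auto
    moreover have "0 \<le> (\<Sum>k=1..d. (x / (real s - 1)) ^ k)"
      using that s by (intro sum_nonneg) auto
    ultimately have "x * (\<Sum>k=1..d. (x / (real s - 1)) ^ k)
        \<le> y * (\<Sum>k=1..d. (y / (real s - 1)) ^ k)"
      using that by (intro mult_mono) auto
    with that show ?thesis by (simp add: g_def)
  qed
  have "\<exists>x\<ge>0. x \<le> 1 \<and> g x = 1"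
  proof (rule IVT')
    show "g 0 \<le> 1" by (simp add: g_def)
    have "0 \<le> (\<Sum>k=1..d. (1 / (real s - 1)) ^ k)"
      using s by (intro sum_nonneg) auto
    then show "1 \<le> g 1" by (simp add: g_def)
    show "continuous_on {0..1} g"
      unfolding g_def using s by (intro continuous_intros) auto
  qed auto
  then obtain x where x: "0 \<le> x" "g x = 1" by blast
  moreover have "x \<noteq> 0" using x by (auto simp: g_def)
  ultimately have "0 < x \<and> g x = 1" by simp
  moreover have "y = x" if "0 < y \<and> g y = 1" for y
    using mono[of x y] mono[of y x] that \<open>0 < x \<and> g x = 1\<close> by (cases x y rule: linorder_cases) auto
  ultimately have "\<exists>!x. 0 < x \<and> g x = 1" by blast
  moreover have "g x = 1 \<longleftrightarrow> 1 - x = x * (\<Sum>k=1..d. (x / (real s - 1)) ^ k)" for x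
    by (auto simp: g_def)
  ultimately show ?thesis by simp
qed

end

theory Submission
  imports Defs "Jordan_Normal_Form.Determinant" "HOL-Number_Theory.Cong"
begin

text \<open>Let \<open>q\<^sub>0 < q\<^sub>1 < \<dots>\<close> be denominators of best approximations to \<open>\<Xi>\<^sub>f\<close> chosen greedily so that
  the integer points \<open>w\<^sub>k\<close> above them are linearly independent, and let \<open>p\<^sub>k\<close> be the best denominator
  just before \<open>q\<^sub>k\<close>; its point lies in the span of the earlier \<open>w\<^sub>j\<close>. Subtracting \<open>q\<^sub>k / p\<^sub>k\<close> times
  that point from \<open>w\<^sub>k\<close> does not change the nonzero integer determinant of the \<open>w\<^sub>k\<close>, and leaves a
  row of size at most \<open>2 \<epsilon> q\<^sub>k powr (1 - H) / p\<^sub>k\<close>, if \<open>H\<close> is exceeded by an admissible exponent.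
  The anisotropic form \<open>f\<close> enters only through the bound \<open>p\<^sub>k \<ge> c q\<^sub>k powr (H / (s - 1))\<close>. With it, the
  product of the row sizes telescopes to a small constant exactly when \<open>H\<close> satisfies the
  equation of \<open>H_root\<close>, which contradicts the determinant being a nonzero integer.\<close>

section \<open>Integer rows and determinants\<close>

text \<open>Membership in the span of the first \<open>k\<close> vectors, read on the coordinates
  below \<open>n\<close>. The coefficients are real because they serve as row operations on a real
  matrix.\<close>

definition in_real_span :: "nat \<Rightarrow> (nat \<Rightarrow> nat \<Rightarrow> int) \<Rightarrow> nat \<Rightarrow> (nat \<Rightarrow> int) \<Rightarrow> bool" where
  "in_real_span n w k x \<longleftrightarrow>
     (\<exists>l::nat \<Rightarrow> real. \<forall>i<n. real_of_int (x i) = (\<Sum>j<k. l j * real_of_int (w j i)))"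

lemma in_real_span_earlier:
  assumes "j < k"
  shows "in_real_span n w k (w j)"
  unfolding in_real_span_def
proof (intro exI allI impI)
  fix i
  have "(\<Sum>j'<k. (if j' = j then 1 else 0) * real_of_int (w j' i))
      = (\<Sum>j'<k. if j' = j then real_of_int (w j' i) else 0)"
    by (intro sum.cong) auto
  then show "real_of_int (w j i) = (\<Sum>j'<k. (if j' = j then 1 else 0) * real_of_int (w j' i))"
    using assms by simp
qed

text \<open>Padded with zero rows to a square matrix, fewer than \<open>n\<close> vectors give
  determinant 0. Over the integral domain of integers this already yields a nonzero kernel vector
  with integer entries.\<close>

lemma orthogonal_int_vector:
  fixes w :: "nat \<Rightarrow> nat \<Rightarrow> int"
  assumes "k < n"
  obtains u where "\<exists>i<n. u i \<noteq> 0" and "\<And>j. j < k \<Longrightarrow> (\<Sum>i<n. u i * w j i) = 0"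
proof -
  define A where "A = mat n n (\<lambda>(i, j). if i < k then w i j else 0)"
  have A: "A \<in> carrier_mat n n" by (simp add: A_def)
  have "transpose_mat A *\<^sub>v unit_vec n k = 0\<^sub>v n"
    using assms by (intro eq_vecI) (auto simp: A_def scalar_prod_def intro!: sum.neutral)
  moreover have "unit_vec n k \<noteq> (0\<^sub>v n :: int vec)"
    using assms by (metis index_unit_vec(2) index_zero_vec(1) zero_neq_one)
  moreover have "transpose_mat A \<in> carrier_mat n n" using A by simp
  ultimately have "det (transpose_mat A) = 0"
    using det_0_iff_vec_prod_zero[of "transpose_mat A" n] unit_vec_carrier[of n k] by blast
  then have "det A = 0" using det_transpose[OF A] by simp
  then obtain v where v: "v \<in> carrier_vec n" "v \<noteq> 0\<^sub>v n" "A *\<^sub>v v = 0\<^sub>v n"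
    using det_0_iff_vec_prod_zero[OF A] by blast
  show thesis
  proof (rule that[of "\<lambda>i. v $ i"])
    show "\<exists>i<n. v $ i \<noteq> 0"
      using v(1,2) by (metis carrier_vecD eq_vecI index_zero_vec(1,2))
    fix j assume j: "j < k"
    have "(A *\<^sub>v v) $ j = 0" using v(3) j assms by simp
    then show "(\<Sum>i<n. v $ i * w j i) = 0"
      using j assms v(1)
      by (simp add: A_def scalar_prod_def atLeast0LessThan mult.commute)
  qed
qed

text \<open>Each of the \<open>n!\<close> terms of the Leibniz formula takes one entry from every
  row.\<close>

lemma abs_det_le:
  fixes A :: "real mat"
  assumes A: "A \<in> carrier_mat n n"
    and bnd: "\<And>i j. i < n \<Longrightarrow> j < n \<Longrightarrow> \<bar>A $$ (i, j)\<bar> \<le> R i"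
  shows "\<bar>det A\<bar> \<le> fact n * (\<Prod>i<n. R i)"
proof -
  have "\<bar>det A\<bar> \<le> (\<Sum>p\<in>{p. p permutes {0..<n}}. \<bar>signof p * (\<Prod>i=0..<n. A $$ (i, p i))\<bar>)"
    unfolding det_def'[OF A] by (rule sum_abs)
  also have "\<dots> \<le> (\<Sum>p\<in>{p. p permutes {0..<n}}. (\<Prod>i<n. R i))"
  proof (rule sum_mono)
    fix p assume "p \<in> {p. p permutes {0..<n}}"
    then have p: "p i < n" if "i < n" for i
      using that permutes_in_image[of p "{0..<n}" i] by auto
    have "\<bar>signof p * (\<Prod>i=0..<n. A $$ (i, p i))\<bar> = (\<Prod>i<n. \<bar>A $$ (i, p i)\<bar>)"
      by (simp add: abs_mult abs_prod sign_def atLeast0LessThan)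
    also have "\<dots> \<le> (\<Prod>i<n. R i)"
      using bnd p by (intro prod_mono) auto
    finally show "\<bar>signof p * (\<Prod>i=0..<n. A $$ (i, p i))\<bar> \<le> (\<Prod>i<n. R i)" .
  qed
  also have "\<dots> = fact n * (\<Prod>i<n. R i)"
    by (simp add: card_permutations[of "{0..<n}" n])
  finally show ?thesis .
qed

text \<open>A vanishing determinant gives a nontrivial relation between the rows; solved for the
  last row with a nonzero coefficient, it puts that row into the span of the earlier ones.\<close>

lemma det_nonzero_if_not_in_span:
  fixes w :: "nat \<Rightarrow> nat \<Rightarrow> int"
  assumes indep: "\<And>k. k < n \<Longrightarrow> \<not> in_real_span n w k (w k)"
  shows "det (mat n n (\<lambda>(i, j). w i j)) \<noteq> 0"
proof
  define W where "W = mat n n (\<lambda>(i, j). w i j)"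
  have W: "W \<in> carrier_mat n n" by (simp add: W_def)
  assume "det (mat n n (\<lambda>(i, j). w i j)) = 0"
  then have "det (transpose_mat W) = 0" using det_transpose[OF W] by (simp add: W_def)
  then obtain v where v: "v \<in> carrier_vec n" "v \<noteq> 0\<^sub>v n" "transpose_mat W *\<^sub>v v = 0\<^sub>v n"
    using det_0_iff_vec_prod_zero[of "transpose_mat W" n] W by auto
  have rel: "(\<Sum>j<n. v $ j * w j i) = 0" if "i < n" for i
  proof -
    have "(transpose_mat W *\<^sub>v v) $ i = 0" using v(3) that by simp
    then show ?thesis
      using that v(1) by (simp add: W_def scalar_prod_def atLeast0LessThan mult.commute)
  qed
  have "\<exists>i<n. v $ i \<noteq> 0"
    using v(1,2) by (metis carrier_vecD eq_vecI index_zero_vec(1,2))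
  define k where "k = Max {i. i < n \<and> v $ i \<noteq> 0}"
  have "k \<in> {i. i < n \<and> v $ i \<noteq> 0}"
    unfolding k_def using \<open>\<exists>i<n. v $ i \<noteq> 0\<close> by (intro Max_in) auto
  then have k: "k < n" "v $ k \<noteq> 0" by auto
  have above: "v $ j = 0" if "k < j" "j < n" for j
  proof (rule ccontr)
    assume "v $ j \<noteq> 0"
    then have "j \<le> k" unfolding k_def using that by (intro Max_ge) auto
    with that show False by simp
  qed
  have "in_real_span n w k (w k)"
    unfolding in_real_span_def
  proof (intro exI allI impI)
    fix i assume i: "i < n"
    have "(\<Sum>j<n. v $ j * w j i) = (\<Sum>j<Suc k. v $ j * w j i)"
      using k above by (intro sum.mono_neutral_right) auto
    with rel[OF i] have "(\<Sum>j<k. v $ j * w j i) + v $ k * w k i = 0" by simp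
    then have "real_of_int ((\<Sum>j<k. v $ j * w j i) + v $ k * w k i) = 0" by simp
    then have "real_of_int (v $ k) * real_of_int (w k i)
        = - (\<Sum>j<k. real_of_int (v $ j) * real_of_int (w j i))"
      by (simp add: add_eq_0_iff)
    then have "real_of_int (w k i)
        = - (\<Sum>j<k. real_of_int (v $ j) * real_of_int (w j i)) / real_of_int (v $ k)"
      using k(2) by (simp add: field_simps)
    also have "\<dots> = (\<Sum>j<k. (- real_of_int (v $ j) / real_of_int (v $ k)) * real_of_int (w j i))"
      by (simp add: sum_divide_distrib sum_negf)
    finally show "real_of_int (w k i)
        = (\<Sum>j<k. (- real_of_int (v $ j) / real_of_int (v $ k)) * real_of_int (w j i))" .
  qed
  with indep k(1) show False by blast
qed

text \<open>The unitriangular \<open>L\<close> subtracts earlier rows, and \<open>T\<close> passes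
  from the coordinates of a point to its first coordinate and its distances to the line through
  \<open>(1, \<theta>)\<close>. Both have determinant of absolute value 1, so the nonzero integer
  determinant of the rows \<open>w k\<close> survives and can be bounded row by row.\<close>

lemma one_le_prod_reduced_rows:
  fixes w :: "nat \<Rightarrow> nat \<Rightarrow> int" and \<theta> R :: "nat \<Rightarrow> real" and l :: "nat \<Rightarrow> nat \<Rightarrow> real"
  assumes indep: "\<And>k. k < Suc m \<Longrightarrow> \<not> in_real_span (Suc m) w k (w k)"
    and u: "\<And>k i. k < Suc m \<Longrightarrow> i < Suc m \<Longrightarrow>
              u k i = real_of_int (w k i) - (\<Sum>j<k. l k j * real_of_int (w j i))"
    and R0: "\<And>k. k < Suc m \<Longrightarrow> \<bar>u k 0\<bar> \<le> R k"
    and R: "\<And>k j. k < Suc m \<Longrightarrow> j < m \<Longrightarrow> \<bar>u k 0 * \<theta> j - u k (Suc j)\<bar> \<le> R k"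
  shows "1 \<le> fact (Suc m) * (\<Prod>k<Suc m. R k)"
proof -
  define n where "n = Suc m"
  define W where "W = mat n n (\<lambda>(i, j). w i j)"
  define W' where "W' = map_mat real_of_int W"
  define L where "L = mat n n (\<lambda>(i, j). if j < i then - l i j else if j = i then 1 else (0::real))"
  define T where "T = mat n n (\<lambda>(i, j). if i = 0 then (if j = 0 then 1 else \<theta> (j - 1))
                                        else if j = i then - 1 else (0::real))"
  have W: "W \<in> carrier_mat n n" and W': "W' \<in> carrier_mat n n"
    and L: "L \<in> carrier_mat n n" and T: "T \<in> carrier_mat n n"
    by (simp_all add: W_def W'_def L_def T_def)
  have "det W \<noteq> 0"
    unfolding W_def using indep by (intro det_nonzero_if_not_in_span) (simp_all add: n_def)
  then have "1 \<le> \<bar>det W\<bar>" by simp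
  moreover have "det W' = real_of_int (det W)"
    unfolding W'_def by simp
  ultimately have detW': "1 \<le> \<bar>det W'\<bar>" by simp
  have "det L = prod_list (diag_mat L)"
    by (rule det_lower_triangular[OF _ L]) (simp add: L_def)
  also have "\<dots> = 1" by (simp add: prod_list_diag_prod L_def)
  finally have detL: "det L = 1" .
  have "det T = prod_list (diag_mat T)"
    by (rule det_upper_triangular[OF _ T]) (auto simp: T_def upper_triangular_def)
  then have "\<bar>det T\<bar> = (\<Prod>i<n. \<bar>T $$ (i, i)\<bar>)"
    using T by (simp add: prod_list_diag_prod abs_prod atLeast0LessThan)
  also have "\<dots> = 1" by (intro prod.neutral) (auto simp: T_def)
  finally have detT: "\<bar>det T\<bar> = 1" .
  have LW: "(L * W') $$ (k, i) = u k i" if "k < n" "i < n" for k i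
  proof -
    have "(L * W') $$ (k, i) = (\<Sum>j<n. L $$ (k, j) * real_of_int (w j i))"
      using that by (simp add: L_def W'_def W_def scalar_prod_def atLeast0LessThan)
    also have "\<dots> = (\<Sum>j<Suc k. L $$ (k, j) * real_of_int (w j i))"
      using that by (intro sum.mono_neutral_right) (auto simp: L_def)
    also have "\<dots> = real_of_int (w k i) + (\<Sum>j<k. L $$ (k, j) * real_of_int (w j i))"
      using that by (simp add: L_def)
    also have "(\<Sum>j<k. L $$ (k, j) * real_of_int (w j i)) = (\<Sum>j<k. - (l k j * real_of_int (w j i)))"
      using that by (intro sum.cong) (auto simp: L_def)
    finally show ?thesis using u that by (simp add: sum_negf n_def)
  qed
  have LWc: "L * W' \<in> carrier_mat n n" using L W' by simp
  have entry: "(L * W' * T) $$ (k, i) = (\<Sum>j<n. u k j * T $$ (j, i))" if "k < n" "i < n" for k i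
  proof -
    have "(M * T) $$ (k, i) = (\<Sum>j<n. M $$ (k, j) * T $$ (j, i))" if "M \<in> carrier_mat n n" for M
      using \<open>k < n\<close> \<open>i < n\<close> that T by (simp add: scalar_prod_def atLeast0LessThan)
    from this[OF LWc]
    have "(L * W' * T) $$ (k, i) = (\<Sum>j<n. (L * W') $$ (k, j) * T $$ (j, i))" .
    also have "\<dots> = (\<Sum>j<n. u k j * T $$ (j, i))"
      using \<open>k < n\<close> by (intro sum.cong) (auto simp: LW)
    finally show ?thesis .
  qed
  have col0: "(L * W' * T) $$ (k, 0) = u k 0" if "k < n" for k
  proof -
    have "(\<Sum>j<n. u k j * T $$ (j, 0)) = (\<Sum>j\<in>{0}. u k j * T $$ (j, 0))"
      by (intro sum.mono_neutral_right) (auto simp: T_def n_def)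
    then show ?thesis using entry[of k 0] that by (simp add: T_def n_def)
  qed
  have colS: "(L * W' * T) $$ (k, Suc i) = u k 0 * \<theta> i - u k (Suc i)" if "k < n" "i < m" for k i
  proof -
    have "(\<Sum>j<n. u k j * T $$ (j, Suc i)) = (\<Sum>j\<in>{0, Suc i}. u k j * T $$ (j, Suc i))"
      using that by (intro sum.mono_neutral_right) (auto simp: T_def n_def)
    then show ?thesis using entry[of k "Suc i"] that by (simp add: T_def n_def)
  qed
  have "\<bar>det (L * W' * T)\<bar> \<le> fact n * (\<Prod>i<n. R i)"
  proof (rule abs_det_le)
    show "L * W' * T \<in> carrier_mat n n" using LWc T by simp
    fix k j assume kj: "k < n" "j < n"
    show "\<bar>(L * W' * T) $$ (k, j)\<bar> \<le> R k"
    proof (cases j)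
      case 0
      then show ?thesis using R0 kj col0 by (simp add: n_def)
    next
      case (Suc i)
      then have "i < m" using kj by (simp add: n_def)
      then show ?thesis using R colS kj Suc by (simp add: n_def)
    qed
  qed
  moreover have "\<bar>det (L * W' * T)\<bar> = \<bar>det W'\<bar>"
    using det_mult[OF LWc T] det_mult[OF L W'] detL detT by (simp add: abs_mult)
  ultimately show ?thesis using detW' by (simp add: n_def)
qed

lemma in_real_span_cong:
  assumes "\<And>j. j < k \<Longrightarrow> w j = w' j"
  shows "in_real_span n w k x \<longleftrightarrow> in_real_span n w' k x"
proof -
  have "(\<Sum>j<k. l j * real_of_int (w j i)) = (\<Sum>j<k. l j * real_of_int (w' j i))"
    for l :: "nat \<Rightarrow> real" and i
    using assms by (intro sum.cong) auto
  then show ?thesis by (simp add: in_real_span_def)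
qed

lemma in_real_span_mono:
  assumes "in_real_span n w j x" and "j \<le> k"
  shows "in_real_span n w k x"
proof -
  from assms(1) obtain l :: "nat \<Rightarrow> real"
    where l: "\<And>i. i < n \<Longrightarrow> real_of_int (x i) = (\<Sum>h<j. l h * real_of_int (w h i))"
    by (auto simp: in_real_span_def)
  have "(\<Sum>h<k. (if h < j then l h else 0) * real_of_int (w h i))
      = (\<Sum>h<j. (if h < j then l h else 0) * real_of_int (w h i))" for i
    using assms(2) by (intro sum.mono_neutral_right) auto
  then show ?thesis
    unfolding in_real_span_def using l
    by (intro exI[of _ "\<lambda>h. if h < j then l h else 0"]) simp
qed

section \<open>Best simultaneous approximations\<close>

text \<open>The distance of \<open>q * \<theta>\<close> to the integer lattice in the maximum
  norm.\<close>

definition apx_err :: "nat \<Rightarrow> (nat \<Rightarrow> real) \<Rightarrow> nat \<Rightarrow> real" where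
  "apx_err m \<theta> q = (MAX j\<in>{..<m}. \<bar>real q * \<theta> j - real_of_int (round (real q * \<theta> j))\<bar>)"

definition apx_vec :: "(nat \<Rightarrow> real) \<Rightarrow> nat \<Rightarrow> nat \<Rightarrow> int" where
  "apx_vec \<theta> q i = (case i of 0 \<Rightarrow> int q | Suc j \<Rightarrow> round (real q * \<theta> j))"

text \<open>Taking the least minimiser breaks ties, so that every smaller denominator has a strictly
  larger error.\<close>

definition best_denom :: "nat \<Rightarrow> (nat \<Rightarrow> real) \<Rightarrow> nat \<Rightarrow> nat" where
  "best_denom m \<theta> Q =
     (LEAST q. 1 \<le> q \<and> q \<le> Q \<and> (\<forall>r. 1 \<le> r \<and> r \<le> Q \<longrightarrow> apx_err m \<theta> q \<le> apx_err m \<theta> r))"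

locale totally_irrational_point =
  fixes m :: nat and \<theta> :: "nat \<Rightarrow> real"
  assumes m_pos: "0 < m" and irrational: "totally_irrational m \<theta>"
begin

abbreviation err :: "nat \<Rightarrow> real" where "err \<equiv> apx_err m \<theta>"
abbreviation best :: "nat \<Rightarrow> nat" where "best \<equiv> best_denom m \<theta>"
abbreviation vec_of :: "nat \<Rightarrow> nat \<Rightarrow> int" where "vec_of \<equiv> apx_vec \<theta>"

lemma vec_of_0 [simp]: "vec_of q 0 = int q"
  by (simp add: apx_vec_def)

lemma vec_of_Suc [simp]: "vec_of q (Suc j) = round (real q * \<theta> j)"
  by (simp add: apx_vec_def)

lemma abs_le_err: "j < m \<Longrightarrow> \<bar>real q * \<theta> j - real_of_int (round (real q * \<theta> j))\<bar> \<le> err q"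
  unfolding apx_err_def by (intro Max_ge) auto

lemma err_le:
  assumes "\<And>j. j < m \<Longrightarrow> \<bar>real q * \<theta> j - real_of_int (round (real q * \<theta> j))\<bar> \<le> B"
  shows "err q \<le> B"
  unfolding apx_err_def using assms m_pos by (subst Max_le_iff) auto

lemma err_nonneg: "0 \<le> err q"
  using abs_le_err[OF m_pos, of q] by linarith

lemma err_le_half: "err q \<le> 1 / 2"
  using of_int_round_abs_le by (intro err_le) (simp add: abs_minus_commute)

text \<open>A vanishing error would make \<open>q * \<theta> 0\<close> an integer, which is a
  nontrivial relation between 1 and \<open>\<theta> 0\<close>.\<close>

lemma err_pos:
  assumes "1 \<le> q"
  shows "0 < err q"
proof (rule ccontr)
  assume "\<not> 0 < err q"
  then have *: "real q * \<theta> 0 = real_of_int (round (real q * \<theta> 0))"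
    using abs_le_err[OF m_pos, of q] by simp
  define a :: "nat \<Rightarrow> int" where "a = (\<lambda>j. if j = 0 then int q else 0)"
  have "(\<Sum>j<m. real_of_int (a j) * \<theta> j) = (\<Sum>j\<in>{0}. real_of_int (a j) * \<theta> j)"
    using m_pos by (intro sum.mono_neutral_right) (auto simp: a_def)
  then have "real_of_int (- round (real q * \<theta> 0)) + (\<Sum>j<m. real_of_int (a j) * \<theta> j) = 0"
    using * by (simp add: a_def)
  then have "a 0 = 0"
    using irrational m_pos unfolding totally_irrational_def by blast
  with assms show False by (simp add: a_def)
qed

lemma best_props:
  assumes "1 \<le> Q"
  shows best_ge_1: "1 \<le> best Q" and best_le: "best Q \<le> Q"
    and err_best_le: "\<And>r. 1 \<le> r \<Longrightarrow> r \<le> Q \<Longrightarrow> err (best Q) \<le> err r"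
proof -
  obtain q where "is_arg_min err (\<lambda>x. x \<in> {1..Q}) q"
    using assms ex_is_arg_min_if_finite[of "{1..Q}" err] by auto
  then have "\<exists>q. 1 \<le> q \<and> q \<le> Q \<and> (\<forall>r. 1 \<le> r \<and> r \<le> Q \<longrightarrow> err q \<le> err r)"
    unfolding is_arg_min_linorder by (intro exI[of _ q]) simp
  from LeastI_ex[OF this]
  show "1 \<le> best Q" "best Q \<le> Q" "\<And>r. 1 \<le> r \<Longrightarrow> r \<le> Q \<Longrightarrow> err (best Q) \<le> err r"
    unfolding best_denom_def by auto
qed

lemma best_denom_le:
  assumes "1 \<le> q" "q \<le> Q" "\<And>r. 1 \<le> r \<Longrightarrow> r \<le> Q \<Longrightarrow> err q \<le> err r"
  shows "best Q \<le> q"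
  unfolding best_denom_def using assms by (intro Least_le) auto

lemma err_best_less:
  assumes "1 \<le> Q" "1 \<le> r" "r < best Q"
  shows "err (best Q) < err r"
proof (rule ccontr)
  assume "\<not> err (best Q) < err r"
  then have *: "err r \<le> err r'" if "1 \<le> r'" "r' \<le> Q" for r'
    using err_best_le[OF assms(1) that] by linarith
  have "r \<le> Q" using assms(3) best_le[OF assms(1)] by simp
  then have "best Q \<le> r" using * assms(2) by (intro best_denom_le)
  with assms(3) show False by simp
qed

lemma best_mono:
  assumes "1 \<le> Q" "Q \<le> Q'"
  shows "best Q \<le> best Q'"
proof (cases "best Q' \<le> Q")
  case True
  have "1 \<le> Q'" using assms by simp
  then show ?thesis
    using True assms best_ge_1[of Q'] err_best_le[of Q'] by (intro best_denom_le[of "best Q'" Q]) simp_all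
next
  case False
  then show ?thesis using best_le[OF assms(1)] by simp
qed

text \<open>A minimiser up to \<open>Suc Q\<close> that differs from \<open>Suc Q\<close> already
  competes up to \<open>Q\<close>; hence the best denominator can only change by jumping to the new
  bound.\<close>

lemma best_Suc:
  assumes "1 \<le> Q" "best (Suc Q) \<noteq> Suc Q"
  shows "best (Suc Q) = best Q"
proof (rule antisym)
  have le: "best (Suc Q) \<le> Q" and ge: "1 \<le> best (Suc Q)"
    using best_le[of "Suc Q"] best_ge_1[of "Suc Q"] assms by auto
  have "err (best Q) \<le> err (best (Suc Q))"
    using err_best_le[OF assms(1) ge le] .
  then have "err (best Q) \<le> err r" if "1 \<le> r" "r \<le> Suc Q" for r
    using err_best_le[of "Suc Q" r] that by simp
  then show "best (Suc Q) \<le> best Q"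
    using best_ge_1[OF assms(1)] best_le[OF assms(1)]
    by (intro best_denom_le[of "best Q" "Suc Q"]) simp_all
  show "best Q \<le> best (Suc Q)"
    using assms by (intro best_mono) auto
qed

text \<open>If all best denominators stayed below \<open>B\<close>, their errors could not drop
  below the positive number \<open>err (best B)\<close>.\<close>

lemma best_unbounded:
  assumes lim: "(\<lambda>Q. err (best Q)) \<longlonglongrightarrow> 0"
  shows "\<exists>Q\<ge>1. B \<le> best Q"
proof (rule ccontr)
  assume *: "\<not> (\<exists>Q\<ge>1. B \<le> best Q)"
  have B: "1 \<le> B" using * by (metis le_zero_eq nat_le_linear not_less_eq_eq One_nat_def order_refl)
  have "\<forall>\<^sub>F Q in sequentially. err (best Q) < err (best B)"
    using lim err_pos[OF best_ge_1[OF B]] by (intro order_tendstoD) auto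
  moreover have "\<forall>\<^sub>F Q in sequentially. B \<le> Q" by (rule eventually_ge_at_top)
  ultimately have "\<forall>\<^sub>F Q in sequentially. err (best Q) < err (best B) \<and> B \<le> Q"
    by eventually_elim auto
  then obtain Q where Q: "err (best Q) < err (best B)" "B \<le> Q"
    by (auto simp: eventually_sequentially)
  have "best Q < B" using * Q(2) B by (meson le_trans not_le)
  then have "err (best B) \<le> err (best Q)"
    using Q(2) B best_ge_1[of Q] by (intro err_best_le) auto
  with Q(1) show False by simp
qed

text \<open>The limit of an integer linear relation satisfied by all best approximations would be a
  relation between \<open>1\<close> and the \<open>\<theta> j\<close>.\<close>

lemma ex_not_in_real_span:
  assumes lim: "(\<lambda>Q. err (best Q)) \<longlonglongrightarrow> 0" and k: "k < Suc m"
  shows "\<exists>Q\<ge>l. \<not> in_real_span (Suc m) w k (vec_of (best Q))"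
proof (rule ccontr)
  assume *: "\<not> ?thesis"
  obtain u where u0: "\<exists>i<Suc m. u i \<noteq> 0"
    and u: "\<And>j. j < k \<Longrightarrow> (\<Sum>i<Suc m. u i * w j i) = 0"
    using orthogonal_int_vector[OF k, of w] by blast
  define S where "S = (\<Sum>j<m. \<bar>real_of_int (u (Suc j))\<bar>)"
  define \<Lambda> where "\<Lambda> = real_of_int (u 0) + (\<Sum>j<m. real_of_int (u (Suc j)) * \<theta> j)"
  \<comment> \<open>\<open>Suc l\<close> rather than \<open>l\<close> also ensures
    \<open>1 \<le> Q\<close>. Every point in the span is orthogonal to \<open>u\<close>, so
    \<open>q * \<Lambda>\<close> consists of rounding errors only.\<close>
  have bound: "\<bar>\<Lambda>\<bar> \<le> S * err (best Q)" if Q: "Suc l \<le> Q" for Q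
  proof -
    define q where "q = best Q"
    have q: "1 \<le> q" using Q best_ge_1[of Q] by (simp add: q_def)
    from * Q obtain \<mu> :: "nat \<Rightarrow> real" where
      \<mu>: "\<And>i. i < Suc m \<Longrightarrow> real_of_int (vec_of q i) = (\<Sum>j<k. \<mu> j * real_of_int (w j i))"
      unfolding in_real_span_def q_def by (meson Suc_leD)
    have "(\<Sum>i<Suc m. real_of_int (u i) * real_of_int (vec_of q i))
        = (\<Sum>i<Suc m. \<Sum>j<k. real_of_int (u i) * (\<mu> j * real_of_int (w j i)))"
      using \<mu> by (intro sum.cong) (auto simp: sum_distrib_left)
    also have "\<dots> = (\<Sum>j<k. \<Sum>i<Suc m. real_of_int (u i) * (\<mu> j * real_of_int (w j i)))"
      by (rule sum.swap)
    also have "\<dots> = (\<Sum>j<k. \<mu> j * real_of_int (\<Sum>i<Suc m. u i * w j i))"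
      by (intro sum.cong refl) (simp add: sum_distrib_left algebra_simps)
    also have "\<dots> = 0" using u by simp
    finally have "real_of_int (u 0) * real q
        + (\<Sum>j<m. real_of_int (u (Suc j)) * real_of_int (round (real q * \<theta> j))) = 0"
      by (subst (asm) sum.lessThan_Suc_shift) simp
    then have "real q * \<Lambda>
        = (\<Sum>j<m. real_of_int (u (Suc j)) * (real q * \<theta> j - real_of_int (round (real q * \<theta> j))))"
      by (simp add: \<Lambda>_def algebra_simps sum_subtractf sum_distrib_left)
    then have "\<bar>real q * \<Lambda>\<bar>
        \<le> (\<Sum>j<m. \<bar>real_of_int (u (Suc j)) * (real q * \<theta> j - real_of_int (round (real q * \<theta> j)))\<bar>)"
      using sum_abs by metis
    also have "\<dots> \<le> (\<Sum>j<m. \<bar>real_of_int (u (Suc j))\<bar> * err q)"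
      unfolding abs_mult using abs_le_err by (intro sum_mono mult_left_mono) auto
    also have "\<dots> = S * err q" by (simp add: S_def sum_distrib_right)
    finally have "real q * \<bar>\<Lambda>\<bar> \<le> S * err q" by (simp add: abs_mult)
    moreover have "\<bar>\<Lambda>\<bar> \<le> real q * \<bar>\<Lambda>\<bar>" using q by (simp add: mult_le_cancel_right1)
    ultimately show ?thesis by (simp add: q_def)
  qed
  have "(\<lambda>Q. S * err (best Q)) \<longlonglongrightarrow> S * 0" by (intro tendsto_intros lim)
  then have "\<bar>\<Lambda>\<bar> \<le> S * 0"
    using bound by (intro LIMSEQ_le_const) auto
  then have "\<Lambda> = 0" by simp
  then have "u 0 = 0 \<and> (\<forall>j<m. u (Suc j) = 0)"
    using irrational[unfolded totally_irrational_def, rule_format, of "u 0" "\<lambda>j. u (Suc j)"]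
    unfolding \<Lambda>_def by blast
  with u0 show False using less_Suc_eq_0_disj by auto
qed

text \<open>The condition \<open>j < k\<close> only serves termination, see \<open>greedy_eq\<close>.\<close>

fun greedy :: "nat \<Rightarrow> nat \<Rightarrow> nat" where
  "greedy l k = (LEAST Q. l \<le> Q \<and> \<not> in_real_span (Suc m)
      (\<lambda>j. if j < k then vec_of (best (greedy l j)) else (\<lambda>_. 0)) k (vec_of (best Q)))"

declare greedy.simps [simp del]

lemma greedy_eq:
  "greedy l k = (LEAST Q. l \<le> Q \<and>
     \<not> in_real_span (Suc m) (\<lambda>j. vec_of (best (greedy l j))) k (vec_of (best Q)))"
proof -
  have "in_real_span (Suc m) (\<lambda>j. if j < k then vec_of (best (greedy l j)) else (\<lambda>_. 0)) k x
      \<longleftrightarrow> in_real_span (Suc m) (\<lambda>j. vec_of (best (greedy l j))) k x" for x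
    by (intro in_real_span_cong) simp
  then show ?thesis by (simp only: greedy.simps[of l k])
qed

text \<open>The minimum in \<open>greedy_eq\<close> exists because the best approximations do not
  stay in the span of at most \<open>m\<close> vectors.\<close>

lemma greedy_props:
  fixes l :: nat
  assumes lim: "(\<lambda>Q. err (best Q)) \<longlonglongrightarrow> 0" and k: "k < Suc m"
  defines "W \<equiv> \<lambda>j. vec_of (best (greedy l j))"
  shows greedy_ge: "l \<le> greedy l k"
    and greedy_not_in_span: "\<not> in_real_span (Suc m) W k (W k)"
    and greedy_least: "\<And>Q. l \<le> Q \<Longrightarrow> Q < greedy l k \<Longrightarrow> in_real_span (Suc m) W k (vec_of (best Q))"
proof -
  let ?P = "\<lambda>Q. l \<le> Q \<and> \<not> in_real_span (Suc m) W k (vec_of (best Q))"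
  have eq: "greedy l k = (LEAST Q. ?P Q)" unfolding W_def by (rule greedy_eq)
  have "\<exists>Q. ?P Q" using ex_not_in_real_span[OF lim k] by blast
  then have "?P (greedy l k)" unfolding eq by (rule LeastI_ex)
  then show "l \<le> greedy l k" and "\<not> in_real_span (Suc m) W k (W k)"
    unfolding W_def by simp_all
  show "in_real_span (Suc m) W k (vec_of (best Q))" if "l \<le> Q" "Q < greedy l k" for Q
  proof (rule ccontr)
    assume "\<not> in_real_span (Suc m) W k (vec_of (best Q))"
    with that(1) have "greedy l k \<le> Q" unfolding eq by (intro Least_le conjI)
    with that(2) show False by simp
  qed
qed

text \<open>Otherwise the point chosen at stage \<open>Suc k\<close> would be the one of stage
  \<open>k\<close>, or one passed over before it; either lies in the span of the first
  \<open>Suc k\<close> points.\<close>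

lemma greedy_less:
  fixes l :: nat
  assumes lim: "(\<lambda>Q. err (best Q)) \<longlonglongrightarrow> 0" and k: "Suc k < Suc m"
  shows "greedy l k < greedy l (Suc k)"
proof (rule ccontr)
  assume "\<not> greedy l k < greedy l (Suc k)"
  then consider "greedy l (Suc k) = greedy l k" | "greedy l (Suc k) < greedy l k"
    by linarith
  then have "in_real_span (Suc m) (\<lambda>j. vec_of (best (greedy l j))) (Suc k)
      (vec_of (best (greedy l (Suc k))))"
  proof cases
    case 1
    show ?thesis
      unfolding 1 by (rule in_real_span_earlier[of k "Suc k" "Suc m" "\<lambda>j. vec_of (best (greedy l j))"]) simp
  next
    case 2
    have "k < Suc m" using k by simp
    from greedy_least[OF lim this greedy_ge[OF lim k] 2]
    show ?thesis by (rule in_real_span_mono) simp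
  qed
  with greedy_not_in_span[OF lim k] show False by (rule notE)
qed

end

section \<open>Growth of best denominators and the determinant estimate\<close>

context totally_irrational_point
begin

text \<open>A best approximation \<open>best Q\<close> has not been improved up to \<open>Q\<close>, so it is much better than
  its own size suggests; the gap condition turns this into a lower bound on \<open>best Q\<close>.\<close>

lemma best_growth:
  fixes s Q0 Q :: nat and c H \<epsilon> :: real
  assumes s: "2 \<le> s" and H: "0 < H" "real s - 1 \<le> real s * H" and c: "0 < c"
    and \<epsilon>: "0 < \<epsilon>" "\<epsilon> \<le> 1" "\<epsilon> < c"
    and gap: "\<And>q' q. \<lbrakk>1 \<le> q'; q' < q; err q < err q'\<rbrakk> \<Longrightarrow>
        c \<le> err q * real q ^ (s - 1) \<or> c \<le> err q' ^ s * real q ^ (s - 1)"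
    and small: "\<And>Q. Q0 \<le> Q \<Longrightarrow> err (best Q) * real (Suc Q) powr H \<le> \<epsilon>"
    and Q: "1 \<le> Q" "Q0 + 2 \<le> best Q"
  shows "c powr (1 / (real s - 1)) * real (Suc Q) powr (H / (real s - 1)) \<le> real (best Q)"
proof -
  define p where "p = best Q"
  \<comment> \<open>The best denominator preceding \<open>p\<close>. The summand 2 in
    \<open>Q0 + 2 \<le> best Q\<close> makes \<open>p - 1\<close> positive and at least
    \<open>Q0\<close>, so that \<open>small\<close> applies to it.\<close>
  define q where "q = best (p - 1)"
  have p2: "2 \<le> p" "Q0 + 2 \<le> p" using Q by (simp_all add: p_def)
  have "1 \<le> p - 1" using p2 by simp
  then have q: "1 \<le> q" "q < p"
    using best_ge_1[of "p - 1"] best_le[of "p - 1"] by (auto simp: q_def)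
  have less: "err p < err q"
    unfolding p_def using Q(1) q by (intro err_best_less) (auto simp: p_def)
  have "err q * real (Suc (p - 1)) powr H \<le> \<epsilon>"
    unfolding q_def using p2 by (intro small) simp
  then have eq: "err q * real p powr H \<le> \<epsilon>" using p2 by simp
  \<comment> \<open>The second alternative of \<open>gap\<close> is impossible: since
    \<open>s * H \<ge> s - 1\<close>, its right-hand side is at most \<open>\<epsilon> ^ s\<close>,
    which is below \<open>c\<close>.\<close>
  have "\<not> c \<le> err q ^ s * real p ^ (s - 1)"
  proof -
    have "real p ^ (s - 1) = real p powr (real s - 1)"
      using p2 s by (simp add: powr_realpow[symmetric] of_nat_diff)
    also have "\<dots> \<le> real p powr (real s * H)"
      using p2 H by (intro powr_mono) auto
    also have "\<dots> = (real p powr H) ^ s"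
      using p2 by (simp add: powr_powr[symmetric] powr_realpow mult.commute)
    finally have "err q ^ s * real p ^ (s - 1) \<le> err q ^ s * (real p powr H) ^ s"
      using err_nonneg by (intro mult_left_mono) auto
    also have "\<dots> = (err q * real p powr H) ^ s" by (simp add: power_mult_distrib)
    also have "\<dots> \<le> \<epsilon> ^ s" using eq err_nonneg by (intro power_mono) auto
    also have "\<dots> \<le> \<epsilon> ^ 1" using \<epsilon> s by (intro power_decreasing) auto
    also have "\<dots> < c" using \<epsilon> by simp
    finally show ?thesis by simp
  qed
  with gap[OF q less] have c_le: "c \<le> err p * real p ^ (s - 1)" by blast
  \<comment> \<open>As \<open>p\<close> is still best at \<open>Q\<close>, its error is controlled
    by the power of \<open>Suc Q\<close>, not merely of \<open>p\<close>.\<close>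
  have "best Q \<le> Q" using best_le Q by simp
  then have "err p * real (Suc Q) powr H \<le> \<epsilon>"
    unfolding p_def using Q by (intro small) simp
  then have ep: "err p * real (Suc Q) powr H \<le> 1" using \<epsilon> by simp
  have "c * real (Suc Q) powr H \<le> (err p * real p ^ (s - 1)) * real (Suc Q) powr H"
    using c_le by (intro mult_right_mono) auto
  also have "\<dots> = (err p * real (Suc Q) powr H) * real p ^ (s - 1)" by simp
  also have "\<dots> \<le> 1 * real p ^ (s - 1)" using ep by (intro mult_right_mono) auto
  finally have "c * real (Suc Q) powr H \<le> real p ^ (s - 1)" by simp
  also have "\<dots> = real p powr (real s - 1)"
    using p2 s by (simp add: powr_realpow[symmetric] of_nat_diff)
  finally have "(c * real (Suc Q) powr H) powr (1 / (real s - 1))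
      \<le> (real p powr (real s - 1)) powr (1 / (real s - 1))"
    using c s by (intro powr_mono2) auto
  also have "\<dots> = real p" using s p2 by (simp add: powr_powr)
  finally show ?thesis using c by (simp add: powr_mult powr_powr p_def)
qed

text \<open>The \<open>m + 1\<close> reduced rows must have a product of sizes at least
  \<open>1 / (m + 1)!\<close>, but \<open>small\<close> pushes it below that bound. The hypothesis
  \<open>gap\<close> carries the arithmetic of the form, and \<open>H_eq\<close> is the balance in
  which the powers of the denominators cancel.\<close>

lemma uniform_approximation_contradiction:
  fixes s :: nat and c H t :: real
  assumes s: "2 \<le> s" and H: "0 < H" "real s - 1 \<le> real s * H"
    and t: "t = H / (real s - 1)" and H_eq: "H * (\<Sum>j<m. t ^ j) = 1"
    and c: "0 < c" "c \<le> 1"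
    and gap: "\<And>q' q. \<lbrakk>1 \<le> q'; q' < q; err q < err q'\<rbrakk> \<Longrightarrow>
        c \<le> err q * real q ^ (s - 1) \<or> c \<le> err q' ^ s * real q ^ (s - 1)"
    and small: "\<And>\<epsilon>. 0 < \<epsilon> \<Longrightarrow> \<forall>\<^sub>F Q in sequentially. err (best Q) * real (Suc Q) powr H \<le> \<epsilon>"
  shows False
proof -
  define c0 where "c0 = c powr (1 / (real s - 1))"
  have c0: "0 < c0" "c0 \<le> 1"
    using c s by (auto simp: c0_def intro!: powr_le1)
  have t0: "0 < t" using s H by (simp add: t)
  have lim: "(\<lambda>Q. err (best Q)) \<longlonglongrightarrow> 0"
  proof (rule order_tendstoI)
    fix a :: real assume "0 < a"
    have "\<forall>\<^sub>F Q in sequentially. err (best Q) * real (Suc Q) powr H \<le> a / 2"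
      using \<open>0 < a\<close> by (intro small) simp
    then show "\<forall>\<^sub>F Q in sequentially. err (best Q) < a"
    proof eventually_elim
      case (elim Q)
      have "1 \<le> real (Suc Q) powr H" using H by (intro ge_one_powr_ge_zero) auto
      then have "err (best Q) \<le> err (best Q) * real (Suc Q) powr H"
        using mult_left_mono[OF _ err_nonneg[of "best Q"]] by fastforce
      with elim \<open>0 < a\<close> show ?case by simp
    qed
  next
    fix a :: real assume "a < 0"
    then show "\<forall>\<^sub>F Q in sequentially. a < err (best Q)"
      using err_nonneg by (simp add: less_le_trans)
  qed
  \<comment> \<open>The bound \<open>c / 2\<close> meets the requirement
    \<open>\<epsilon> < c\<close> of \<open>best_growth\<close>; the last one makes
    \<open>2 * \<epsilon> / c0\<close>, the contribution of each reduced row, at most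
    \<open>1 / (2 * fact (Suc m))\<close>.\<close>
  define \<epsilon> where "\<epsilon> = min 1 (min (c / 2) (c0 / (4 * fact (Suc m))))"
  have \<epsilon>: "0 < \<epsilon>" "\<epsilon> \<le> 1" "\<epsilon> < c" and \<epsilon>': "\<epsilon> \<le> c0 / (4 * fact (Suc m))"
    using c c0 by (auto simp: \<epsilon>_def min_less_iff_disj)
  obtain Q0 where Q0: "\<And>Q. Q0 \<le> Q \<Longrightarrow> err (best Q) * real (Suc Q) powr H \<le> \<epsilon>"
    using small[OF \<epsilon>(1)] by (auto simp: eventually_sequentially)
  \<comment> \<open>Starting this late makes \<open>best_growth\<close> available for all the
    denominators \<open>p k\<close> below, which are at least \<open>best l\<close>.\<close>
  obtain l where l: "1 \<le> l" "Q0 + 2 \<le> best l"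
    using best_unbounded[OF lim] by blast
  have "Q0 \<le> l" using best_le[OF l(1)] l(2) by simp
  define r where "r = greedy l"
  define W where "W = (\<lambda>j. vec_of (best (r j)))"
  have r_ge: "l \<le> r k" if "k < Suc m" for k
    unfolding r_def by (rule greedy_ge[OF lim that])
  have W_indep: "\<not> in_real_span (Suc m) W k (W k)" if "k < Suc m" for k
    unfolding W_def r_def by (rule greedy_not_in_span[OF lim that])
  have r_less: "r k < r (Suc k)" if "Suc k < Suc m" for k
    unfolding r_def by (rule greedy_less[OF lim that])
  \<comment> \<open>The best denominator just before stage \<open>k\<close>: by minimality of
    \<open>r k\<close>, its point still lies in the span of the earlier rows.\<close>
  define p where "p = (\<lambda>k. best (r k - 1))"
  define q where "q = (\<lambda>k. best (r k))"
  have p_span: "in_real_span (Suc m) W k (vec_of (p k))"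
    and p_ge: "q (k - 1) \<le> p k" and p_ge1: "1 \<le> p k"
    and p_small: "err (p k) * real (r k) powr H \<le> \<epsilon>"
    and p_growth: "c0 * real (r k) powr t \<le> real (p k)"
    and p_less: "p k < q k" if k: "0 < k" "k < Suc m" for k
  proof -
    obtain k' where k': "k = Suc k'" using k(1) by (cases k) auto
    have rr: "r k' \<le> r k - 1" "l \<le> r k'" "0 < r k"
      using r_less[of k'] r_ge[of k'] k k' by auto
    have rk: "l \<le> r k - 1" "r k - 1 < r k" using rr by auto
    show span: "in_real_span (Suc m) W k (vec_of (p k))"
      unfolding W_def r_def p_def by (rule greedy_least[OF lim k(2) rk[unfolded r_def]])
    have "1 \<le> r k'" using rr l by simp
    then show "q (k - 1) \<le> p k"
      unfolding p_def q_def using rr k' by (simp add: best_mono)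
    have "1 \<le> r k - 1" using rk l by simp
    then show "1 \<le> p k" unfolding p_def by (rule best_ge_1)
    have SucPred: "Suc (r k - 1) = r k" using rr by simp
    show "err (p k) * real (r k) powr H \<le> \<epsilon>"
      using Q0[of "r k - 1"] rk(1) \<open>Q0 \<le> l\<close> unfolding SucPred p_def by simp
    have "best l \<le> best (r k - 1)" using l rk by (intro best_mono) auto
    then have "Q0 + 2 \<le> best (r k - 1)" using l by simp
    from best_growth[OF s H c(1) \<epsilon> gap Q0 \<open>1 \<le> r k - 1\<close> this]
    show "c0 * real (r k) powr t \<le> real (p k)"
      unfolding SucPred p_def c0_def t by blast
    have "p k \<noteq> q k"
      using span W_indep[OF k(2)] by (auto simp: W_def q_def)
    moreover have "p k \<le> q k"
      unfolding p_def q_def using \<open>1 \<le> r k - 1\<close> by (intro best_mono) auto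
    ultimately show "p k < q k" by simp
  qed
  \<comment> \<open>The best denominator changes at \<open>r k\<close>, so it jumps to
    \<open>r k\<close> itself and bounds in \<open>r k\<close> become bounds in \<open>q k\<close>.
    For \<open>k = 0\<close> there is no such jump to appeal to.\<close>
  have q_eq: "q k = r k" if k: "0 < k" "k < Suc m" for k
  proof -
    have "1 \<le> r k - 1"
    proof -
      have "r (k - 1) < r k" and "l \<le> r (k - 1)"
        using r_less[of "k - 1"] r_ge[of "k - 1"] k by auto
      with l(1) show ?thesis by linarith
    qed
    then show ?thesis
      using best_Suc[of "r k - 1"] p_less[OF k] by (auto simp: p_def q_def)
  qed
  have err_less: "err (q k) < err (p k)" if k: "0 < k" "k < Suc m" for k
    unfolding q_def using p_less[OF k] p_ge1[OF k] r_ge[of k] k l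
    by (intro err_best_less) (auto simp: q_def)
  have q_ge1: "1 \<le> q k" if "k < Suc m" for k
    unfolding q_def using r_ge[OF that] l by (intro best_ge_1) simp
  have "\<forall>k. \<exists>\<mu>::nat \<Rightarrow> real. 0 < k \<and> k < Suc m \<longrightarrow>
      (\<forall>i<Suc m. real_of_int (vec_of (p k) i) = (\<Sum>j<k. \<mu> j * real_of_int (W j i)))"
    using p_span unfolding in_real_span_def by blast
  then obtain \<mu> :: "nat \<Rightarrow> nat \<Rightarrow> real" where \<mu>: "\<And>k i. \<lbrakk>0 < k; k < Suc m; i < Suc m\<rbrakk> \<Longrightarrow>
      real_of_int (vec_of (p k) i) = (\<Sum>j<k. \<mu> k j * real_of_int (W j i))"
    by metis
  \<comment> \<open>The multiplier cancels the first coordinate of row \<open>k\<close>. Row 0 has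
    no earlier rows and stays as it is, hence the value 0.\<close>
  define x where "x = (\<lambda>k. if k = 0 then 0 else real (q k) / real (p k))"
  define u where "u = (\<lambda>k i. real_of_int (W k i) - x k * real_of_int (vec_of (p k) i))"
  \<comment> \<open>For \<open>k > 0\<close> the distances are at most
    \<open>err (q k) + x k * err (p k)\<close>; the first summand is dominated by the second, whence
    the factor 2, and \<open>p_small\<close> bounds \<open>err (p k)\<close>. In row 0 the first
    coordinate \<open>q 0\<close> dominates.\<close>
  define R where "R = (\<lambda>k. if k = 0 then real (q 0)
      else 2 * \<epsilon> * real (q k) powr (1 - H) / real (p k))"
  have one_le: "1 \<le> fact (Suc m) * (\<Prod>k<Suc m. R k)"
  proof (rule one_le_prod_reduced_rows[where w = W and \<theta> = \<theta> and u = u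
        and l = "\<lambda>k j. x k * \<mu> k j"])
    show "\<not> in_real_span (Suc m) W k (W k)" if "k < Suc m" for k
      by (rule W_indep[OF that])
    show "u k i = real_of_int (W k i) - (\<Sum>j<k. x k * \<mu> k j * real_of_int (W j i))"
      if "k < Suc m" "i < Suc m" for k i
    proof (cases "k = 0")
      case False
      then show ?thesis
        using \<mu>[of k i] that by (simp add: u_def sum_distrib_left mult.assoc)
    qed (simp add: u_def x_def)
    have first_zero: "u k 0 = 0" if "0 < k" "k < Suc m" for k
      using p_ge1[OF that] that by (simp add: u_def x_def W_def q_def)
    have R_nonneg: "0 \<le> R k" for k using \<epsilon> by (simp add: R_def)
    show "\<bar>u k 0\<bar> \<le> R k" if "k < Suc m" for k
      using first_zero[of k] R_nonneg[of k] that
      by (cases "k = 0") (auto simp: u_def x_def W_def q_def R_def)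
    show "\<bar>u k 0 * \<theta> j - u k (Suc j)\<bar> \<le> R k" if k: "k < Suc m" and j: "j < m" for k j
    proof (cases "k = 0")
      case True
      have "\<bar>u k 0 * \<theta> j - u k (Suc j)\<bar> \<le> err (q 0)"
        using abs_le_err[OF j, of "q 0"] True by (simp add: u_def x_def W_def q_def)
      also have "\<dots> \<le> real (q 0)"
        using err_le_half[of "q 0"] q_ge1[of 0] by linarith
      finally show ?thesis using True by (simp add: R_def)
    next
      case False
      then have k0: "0 < k" by simp
      define e where "e = (\<lambda>n. real n * \<theta> j - real_of_int (round (real n * \<theta> j)))"
      have pk: "1 \<le> real (p k)" using p_ge1[OF k0 k] by simp
      have x1: "1 \<le> x k" using p_less[OF k0 k] pk k0 by (simp add: x_def)
      have "u k 0 * \<theta> j - u k (Suc j) = e (q k) - x k * e (p k)"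
        by (simp add: u_def e_def W_def q_def algebra_simps)
      also have "\<bar>\<dots>\<bar> \<le> \<bar>e (q k)\<bar> + \<bar>x k * e (p k)\<bar>" by (rule abs_triangle_ineq4)
      also have "\<dots> \<le> err (q k) + x k * err (p k)"
        using abs_le_err[OF j] x1 by (auto simp: e_def abs_mult intro!: add_mono mult_left_mono)
      also have "\<dots> \<le> x k * err (p k) + x k * err (p k)"
        using err_less[OF k0 k] mult_right_mono[OF x1 err_nonneg[of "p k"]] by simp
      also have "\<dots> = 2 * x k * err (p k)" by simp
      also have "\<dots> \<le> 2 * x k * (\<epsilon> / real (q k) powr H)"
        using p_small[OF k0 k] q_ge1[OF k] x1 unfolding q_eq[OF k0 k, symmetric]
        by (intro mult_left_mono) (auto simp: field_simps)
      also have "\<dots> = R k"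
        using k0 q_ge1[OF k] by (simp add: R_def x_def powr_diff field_simps)
      finally show ?thesis .
    qed
  qed
  \<comment> \<open>\<open>\<sigma> (Suc k) = H + t * \<sigma> k\<close> is what one more row costs, since \<open>q k \<le> p (Suc k)\<close> and
    \<open>p (Suc k) \<ge> c0 * q (Suc k) powr t\<close>; the equation for \<open>H\<close> says \<open>\<sigma> m = 1\<close>.\<close>
  define \<sigma> where "\<sigma> = (\<lambda>k. H * (\<Sum>j<k. t ^ j))"
  have \<sigma>_nonneg: "0 \<le> \<sigma> k" for k
    unfolding \<sigma>_def using H t0 by (intro mult_nonneg_nonneg sum_nonneg) auto
  have \<sigma>_le: "\<sigma> k \<le> 1" if "k \<le> m" for k
  proof -
    have "\<sigma> k \<le> \<sigma> m"
      unfolding \<sigma>_def using H t0 that by (intro mult_left_mono sum_mono2) auto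
    then show ?thesis using H_eq by (simp add: \<sigma>_def)
  qed
  have \<sigma>_Suc: "\<sigma> (Suc k) = H + t * \<sigma> k" for k
    unfolding \<sigma>_def sum.lessThan_Suc_shift by (simp add: sum_distrib_left algebra_simps)
  have prod_le: "(\<Prod>j<Suc k. R j) \<le> (2 * \<epsilon> / c0) ^ k * real (q k) powr (1 - \<sigma> k)" if "k \<le> m" for k
    using that
  proof (induction k)
    case 0
    have "0 < real (q 0)" using q_ge1[of 0] by simp
    then show ?case by (simp add: R_def \<sigma>_def)
  next
    case (Suc k)
    have k: "0 < Suc k" "Suc k < Suc m" "k \<le> m" "k < Suc m" using Suc.prems by auto
    define P where "P = real (p (Suc k))"
    define Q where "Q = real (q (Suc k))"
    have P: "1 \<le> P" and Q: "1 \<le> Q"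
      using p_ge1[OF k(1,2)] q_ge1[OF k(2)] by (simp_all add: P_def Q_def)
    have growth: "c0 * Q powr t \<le> P"
      using p_growth[OF k(1,2)] q_eq[OF k(1,2)] by (simp add: P_def Q_def)
    \<comment> \<open>The exponent is nonpositive, so the lower bound for \<open>P\<close> becomes
      an upper bound. Since \<open>c0 \<le> 1\<close> and \<open>\<sigma> k \<le> 1\<close>, the
      loss from the constant is at most one factor \<open>1 / c0\<close>.\<close>
    have "P powr (- \<sigma> k) \<le> (c0 * Q powr t) powr (- \<sigma> k)"
      using growth c0 Q \<sigma>_nonneg by (intro powr_mono2') auto
    also have "\<dots> = c0 powr (- \<sigma> k) * Q powr (- (t * \<sigma> k))"
      using c0 by (simp add: powr_mult powr_powr)
    also have "\<dots> \<le> c0 powr (- 1) * Q powr (- (t * \<sigma> k))"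
      using c0 \<sigma>_le[OF k(3)] by (intro mult_right_mono powr_mono') auto
    also have "\<dots> = Q powr (- (t * \<sigma> k)) / c0"
      using c0 by (simp add: powr_minus divide_simps)
    finally have P_le: "P powr (- \<sigma> k) \<le> Q powr (- (t * \<sigma> k)) / c0" .
    \<comment> \<open>Passing from \<open>q k\<close> to the larger \<open>p (Suc k)\<close> uses
      \<open>\<sigma> k \<le> 1\<close>. The full factor \<open>P\<close> split off here cancels the
      denominator of \<open>R (Suc k)\<close>.\<close>
    have "real (q k) powr (1 - \<sigma> k) \<le> P powr (1 - \<sigma> k)"
      using p_ge[OF k(1,2)] \<sigma>_le[OF k(3)] by (intro powr_mono2) (auto simp: P_def)
    also have "\<dots> = P * P powr (- \<sigma> k)" using P by (simp add: powr_diff powr_minus field_simps)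
    also have "\<dots> \<le> P * (Q powr (- (t * \<sigma> k)) / c0)"
      using P P_le by (intro mult_left_mono) auto
    finally have step: "real (q k) powr (1 - \<sigma> k) \<le> P * (Q powr (- (t * \<sigma> k)) / c0)" .
    have "(\<Prod>j<Suc (Suc k). R j) = (\<Prod>j<Suc k. R j) * R (Suc k)" by simp
    also have "\<dots> \<le> ((2 * \<epsilon> / c0) ^ k * real (q k) powr (1 - \<sigma> k)) * R (Suc k)"
      using Suc.IH k \<epsilon> by (intro mult_right_mono) (auto simp: R_def)
    also have "\<dots> \<le> ((2 * \<epsilon> / c0) ^ k * (P * (Q powr (- (t * \<sigma> k)) / c0))) * R (Suc k)"
      using step \<epsilon> c0 by (intro mult_right_mono mult_left_mono) (auto simp: R_def)
    also have "\<dots> = (2 * \<epsilon> / c0) ^ Suc k * (Q powr (- (t * \<sigma> k)) * Q powr (1 - H))"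
      using P c0 by (simp add: R_def P_def[symmetric] Q_def[symmetric] field_simps)
    also have "Q powr (- (t * \<sigma> k)) * Q powr (1 - H) = Q powr (1 - \<sigma> (Suc k))"
      using Q by (simp add: powr_add[symmetric] \<sigma>_Suc algebra_simps)
    finally show ?case by (simp add: Q_def)
  qed
  \<comment> \<open>The exponent of \<open>q m\<close> is now 0, so the product is bounded
    independently of the size of the denominators.\<close>
  have "\<sigma> m = 1" using H_eq by (simp add: \<sigma>_def)
  then have "(\<Prod>j<Suc m. R j) \<le> (2 * \<epsilon> / c0) ^ m"
    using prod_le[of m] q_ge1[of m] by simp
  also have "\<dots> \<le> (1 / (2 * fact (Suc m))) ^ m"
  proof (rule power_mono)
    have "2 * \<epsilon> / c0 \<le> 2 * (c0 / (4 * fact (Suc m))) / c0"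
      using \<epsilon>' c0 by (intro divide_right_mono mult_left_mono) auto
    also have "\<dots> = 1 / (2 * fact (Suc m))" using c0 by simp
    finally show "2 * \<epsilon> / c0 \<le> 1 / (2 * fact (Suc m))" .
    show "0 \<le> 2 * \<epsilon> / c0" using \<epsilon> c0 by simp
  qed
  also have "\<dots> \<le> (1 / (2 * fact (Suc m))) ^ 1"
  proof (rule power_decreasing)
    have "1 \<le> 2 * (fact (Suc m) :: real)"
      using fact_ge_1[of "Suc m", where ?'a = real] by linarith
    then show "1 / (2 * fact (Suc m)) \<le> (1::real)" by (simp del: fact_Suc)
  qed (use m_pos in auto)
  finally have "fact (Suc m) * (\<Prod>k<Suc m. R k) \<le> fact (Suc m) * (1 / (2 * fact (Suc m)))"
    by (intro mult_left_mono) auto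
  also have "\<dots> = 1 / 2" by simp
  finally show False using one_le by simp
qed

end

section \<open>Integer forms\<close>

text \<open>Integer coefficients make the values at integer points integers, to which congruences
  apply; the generic type lets the same form be evaluated at rational and real points.\<close>

definition int_form ::
    "nat \<Rightarrow> nat \<Rightarrow> ((nat \<Rightarrow> nat) \<Rightarrow> int) \<Rightarrow> (nat \<Rightarrow> 'a::comm_ring_1) \<Rightarrow> 'a" where
  "int_form d s C x = (\<Sum>e\<in>multi_indices d s. of_int (C e) * (\<Prod>i<d. x i ^ e i))"

lemma sum_multi_index: "e \<in> multi_indices d s \<Longrightarrow> (\<Sum>i<d. e i) = s"
  by (simp add: multi_indices_def)

lemma int_form_cong:
  assumes "\<And>i. i < d \<Longrightarrow> x i = y i"
  shows "int_form d s C x = int_form d s C y"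
  unfolding int_form_def using assms by simp

lemma of_int_int_form: "of_int (int_form d s C a) = int_form d s C (\<lambda>i. of_int (a i))"
  by (simp add: int_form_def)

lemma int_form_scale: "int_form d s C (\<lambda>i. t * x i) = t ^ s * int_form d s C x"
proof -
  have "(\<Prod>i<d. (t * x i) ^ e i) = t ^ s * (\<Prod>i<d. x i ^ e i)" if "e \<in> multi_indices d s" for e
  proof -
    have "(\<Prod>i<d. t ^ e i) = t ^ s"
      using sum_multi_index[OF that] by (simp add: power_sum[symmetric])
    then show ?thesis by (simp add: power_mult_distrib prod.distrib)
  qed
  then show ?thesis
    unfolding int_form_def sum_distrib_left by (intro sum.cong refl) (simp add: mult_ac)
qed

lemma int_form_cong_mod:
  fixes a b :: "nat \<Rightarrow> int"
  assumes "\<And>i. i < d \<Longrightarrow> [a i = b i] (mod q)"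
  shows "[int_form d s C a = int_form d s C b] (mod q)"
  unfolding int_form_def using assms
  by (intro cong_sum cong_mult cong_prod cong_pow cong_refl) simp_all

lemma abs_int_form_le:
  fixes x :: "nat \<Rightarrow> real"
  assumes "\<And>i. i < d \<Longrightarrow> \<bar>x i\<bar> \<le> M"
  shows "\<bar>int_form d s C x\<bar> \<le> (\<Sum>e\<in>multi_indices d s. \<bar>real_of_int (C e)\<bar>) * M ^ s"
proof -
  have "\<bar>int_form d s C x\<bar> \<le> (\<Sum>e\<in>multi_indices d s. \<bar>of_int (C e) * (\<Prod>i<d. x i ^ e i)\<bar>)"
    unfolding int_form_def by (rule sum_abs)
  also have "\<dots> \<le> (\<Sum>e\<in>multi_indices d s. \<bar>real_of_int (C e)\<bar> * M ^ s)"
  proof (rule sum_mono)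
    fix e assume e: "e \<in> multi_indices d s"
    have "\<bar>\<Prod>i<d. x i ^ e i\<bar> = (\<Prod>i<d. \<bar>x i\<bar> ^ e i)" by (simp add: abs_prod power_abs)
    also have "\<dots> \<le> (\<Prod>i<d. M ^ e i)" using assms by (intro prod_mono) (auto intro: power_mono)
    also have "\<dots> = M ^ s" using sum_multi_index[OF e] by (simp add: power_sum[symmetric])
    finally show "\<bar>of_int (C e) * (\<Prod>i<d. x i ^ e i)\<bar> \<le> \<bar>real_of_int (C e)\<bar> * M ^ s"
      by (simp add: abs_mult mult_left_mono)
  qed
  finally show ?thesis by (simp add: sum_distrib_right)
qed

section \<open>Lipschitz bounds for forms at a point\<close>

text \<open>One end of the comparison is fixed at \<open>\<xi>\<close>, and \<open>K\<close> is
  uniform on the cube of radius 1 around it. This property passes to sums and products, so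
  polynomials have it without any use of derivatives.\<close>

definition lipschitz_near :: "nat \<Rightarrow> (nat \<Rightarrow> real) \<Rightarrow> ((nat \<Rightarrow> real) \<Rightarrow> real) \<Rightarrow> bool" where
  "lipschitz_near d \<xi> g \<longleftrightarrow>
     (\<exists>K\<ge>0. \<forall>x \<delta>. 0 \<le> \<delta> \<and> \<delta> \<le> 1 \<and> (\<forall>i<d. \<bar>x i - \<xi> i\<bar> \<le> \<delta>) \<longrightarrow> \<bar>g x - g \<xi>\<bar> \<le> K * \<delta>)"

lemma lipschitz_near_const: "lipschitz_near d \<xi> (\<lambda>x. a)"
  unfolding lipschitz_near_def by (intro exI[of _ 0]) simp

lemma lipschitz_near_coord: "i < d \<Longrightarrow> lipschitz_near d \<xi> (\<lambda>x. x i)"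
  unfolding lipschitz_near_def by (intro exI[of _ 1]) simp

lemma lipschitz_near_add:
  assumes "lipschitz_near d \<xi> g" "lipschitz_near d \<xi> h"
  shows "lipschitz_near d \<xi> (\<lambda>x. g x + h x)"
proof -
  from assms obtain K K' where K: "0 \<le> K" "0 \<le> K'"
    and g: "\<And>x \<delta>. 0 \<le> \<delta> \<and> \<delta> \<le> 1 \<and> (\<forall>i<d. \<bar>x i - \<xi> i\<bar> \<le> \<delta>) \<Longrightarrow> \<bar>g x - g \<xi>\<bar> \<le> K * \<delta>"
    and h: "\<And>x \<delta>. 0 \<le> \<delta> \<and> \<delta> \<le> 1 \<and> (\<forall>i<d. \<bar>x i - \<xi> i\<bar> \<le> \<delta>) \<Longrightarrow> \<bar>h x - h \<xi>\<bar> \<le> K' * \<delta>"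
    unfolding lipschitz_near_def by metis
  show ?thesis
    unfolding lipschitz_near_def
  proof (intro exI[of _ "K + K'"] conjI allI impI)
    fix x \<delta> assume A: "0 \<le> \<delta> \<and> \<delta> \<le> 1 \<and> (\<forall>i<d. \<bar>x i - \<xi> i\<bar> \<le> \<delta>)"
    show "\<bar>(g x + h x) - (g \<xi> + h \<xi>)\<bar> \<le> (K + K') * \<delta>"
      using g[OF A] h[OF A] by (simp add: algebra_simps)
  qed (use K in simp)
qed

lemma lipschitz_near_mult:
  assumes "lipschitz_near d \<xi> g" "lipschitz_near d \<xi> h"
  shows "lipschitz_near d \<xi> (\<lambda>x. g x * h x)"
proof -
  from assms obtain K K' where K: "0 \<le> K" "0 \<le> K'"
    and g: "\<And>x \<delta>. 0 \<le> \<delta> \<and> \<delta> \<le> 1 \<and> (\<forall>i<d. \<bar>x i - \<xi> i\<bar> \<le> \<delta>) \<Longrightarrow> \<bar>g x - g \<xi>\<bar> \<le> K * \<delta>"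
    and h: "\<And>x \<delta>. 0 \<le> \<delta> \<and> \<delta> \<le> 1 \<and> (\<forall>i<d. \<bar>x i - \<xi> i\<bar> \<le> \<delta>) \<Longrightarrow> \<bar>h x - h \<xi>\<bar> \<le> K' * \<delta>"
    unfolding lipschitz_near_def by metis
  show ?thesis
    unfolding lipschitz_near_def
  proof (intro exI[of _ "(\<bar>g \<xi>\<bar> + K) * K' + K * \<bar>h \<xi>\<bar>"] conjI allI impI)
    fix x \<delta> assume A: "0 \<le> \<delta> \<and> \<delta> \<le> 1 \<and> (\<forall>i<d. \<bar>x i - \<xi> i\<bar> \<le> \<delta>)"
    \<comment> \<open>The restriction \<open>\<delta> \<le> 1\<close> keeps the factor
      \<open>g x\<close> bounded by a constant.\<close>
    have "K * \<delta> \<le> K" using A K by (simp add: mult_left_le)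
    then have gx: "\<bar>g x\<bar> \<le> \<bar>g \<xi>\<bar> + K" using g[OF A] by linarith
    have "g x * h x - g \<xi> * h \<xi> = g x * (h x - h \<xi>) + (g x - g \<xi>) * h \<xi>"
      by (simp add: algebra_simps)
    also have "\<bar>\<dots>\<bar> \<le> \<bar>g x\<bar> * \<bar>h x - h \<xi>\<bar> + \<bar>g x - g \<xi>\<bar> * \<bar>h \<xi>\<bar>"
      by (metis abs_mult abs_triangle_ineq)
    also have "\<dots> \<le> (\<bar>g \<xi>\<bar> + K) * (K' * \<delta>) + (K * \<delta>) * \<bar>h \<xi>\<bar>"
      using gx g[OF A] h[OF A] K by (intro add_mono mult_mono) auto
    finally show "\<bar>g x * h x - g \<xi> * h \<xi>\<bar> \<le> ((\<bar>g \<xi>\<bar> + K) * K' + K * \<bar>h \<xi>\<bar>) * \<delta>"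
      by (simp add: algebra_simps)
  qed (use K in simp)
qed

lemma lipschitz_near_power:
  "lipschitz_near d \<xi> g \<Longrightarrow> lipschitz_near d \<xi> (\<lambda>x. g x ^ n)"
  by (induction n) (simp_all add: lipschitz_near_const lipschitz_near_mult)

lemma lipschitz_near_prod:
  "finite I \<Longrightarrow> (\<And>i. i \<in> I \<Longrightarrow> lipschitz_near d \<xi> (g i)) \<Longrightarrow> lipschitz_near d \<xi> (\<lambda>x. \<Prod>i\<in>I. g i x)"
  by (induction I rule: finite_induct) (simp_all add: lipschitz_near_const lipschitz_near_mult)

lemma lipschitz_near_sum:
  "finite I \<Longrightarrow> (\<And>i. i \<in> I \<Longrightarrow> lipschitz_near d \<xi> (g i)) \<Longrightarrow> lipschitz_near d \<xi> (\<lambda>x. \<Sum>i\<in>I. g i x)"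
  by (induction I rule: finite_induct) (simp_all add: lipschitz_near_const lipschitz_near_add)

lemma lipschitz_near_int_form: "lipschitz_near d \<xi> (int_form d s C)"
proof -
  have "lipschitz_near d \<xi> (\<lambda>x. \<Sum>e\<in>multi_indices d s. of_int (C e) * (\<Prod>i<d. x i ^ e i))"
    by (intro lipschitz_near_sum finite_multi_indices lipschitz_near_mult lipschitz_near_const
        lipschitz_near_prod lipschitz_near_power lipschitz_near_coord) simp_all
  then show ?thesis by (simp add: int_form_def[abs_def])
qed

section \<open>Clearing denominators and integer zeros of the form\<close>

lemma ex_common_denominator:
  fixes c :: "'b \<Rightarrow> rat"
  assumes "finite I"
  shows "\<exists>N C. (0::int) < N \<and> (\<forall>e\<in>I. of_int N * c e = of_int (C e))"
  using assms
proof (induction I rule: finite_induct)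
  case empty
  show ?case by (intro exI[of _ 1]) simp
next
  case (insert e I)
  then obtain N C where N: "(0::int) < N" and C: "\<And>e'. e' \<in> I \<Longrightarrow> of_int N * c e' = of_int (C e')"
    by blast
  obtain a b where ab: "quotient_of (c e) = (a, b)" by fastforce
  have b: "0 < b" using quotient_of_denom_pos[OF ab] .
  have ce: "c e = of_int a / of_int b" using quotient_of_div[OF ab] .
  have "of_int (b * N) * c e' = of_int (if e' = e then N * a else b * C e')" if "e' \<in> insert e I" for e'
    using that ce b insert.hyps(2) by (auto simp: C[symmetric])
  moreover have "0 < b * N" using b N by simp
  ultimately show ?case by (intro exI[of _ "b * N"] exI) auto
qed

lemma int_form_eq_form_eval:
  fixes x :: "nat \<Rightarrow> 'a::field_char_0"
  assumes "\<And>e. e \<in> multi_indices d s \<Longrightarrow> of_int N * c e = of_int (C e)"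
  shows "int_form d s C x = of_int N * form_eval d s c x"
proof -
  have "of_int (C e) = (of_int N * of_rat (c e) :: 'a)" if "e \<in> multi_indices d s" for e
    using assms[OF that] by (metis of_rat_mult of_rat_of_int_eq)
  then show ?thesis
    unfolding int_form_def form_eval_def sum_distrib_left
    by (intro sum.cong refl) (simp add: mult.assoc)
qed

text \<open>By homogeneity all multiples of an integer zero are zeros; if the zero is nontrivial,
  they are infinitely many rational points, against finiteness. Restricting them to
  \<open>{..<d}\<close> gives each point its extensional representative.\<close>

lemma form_zero_int_imp_zero:
  fixes a :: "nat \<Rightarrow> int"
  assumes fin: "finite {x \<in> {..<d} \<rightarrow>\<^sub>E (UNIV :: rat set). form_eval d s c x = 0}"
    and eq: "\<And>e. e \<in> multi_indices d s \<Longrightarrow> of_int N * c e = of_int (C e)" and N: "0 < N"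
    and zero: "int_form d s C a = 0" and i: "i < d"
  shows "a i = 0"
proof (rule ccontr)
  assume ai: "a i \<noteq> 0"
  define X where "X = (\<lambda>n::nat. restrict (\<lambda>j. of_nat n * (of_int (a j) :: rat)) {..<d})"
  have "form_eval d s c (X n) = 0" for n
  proof -
    have "int_form d s C (X n) = int_form d s C (\<lambda>j. of_nat n * (of_int (a j) :: rat))"
      by (intro int_form_cong) (simp add: X_def)
    also have "\<dots> = of_nat n ^ s * of_int (int_form d s C a)"
      by (simp add: int_form_scale of_int_int_form)
    finally show ?thesis using zero N int_form_eq_form_eval[OF eq, where x = "X n"] by simp
  qed
  moreover have "X n \<in> {..<d} \<rightarrow>\<^sub>E UNIV" for n
    by (simp add: X_def)
  ultimately have "range X \<subseteq> {x \<in> {..<d} \<rightarrow>\<^sub>E (UNIV :: rat set). form_eval d s c x = 0}"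
    by blast
  then have "finite (range X)" using fin finite_subset by blast
  moreover have "inj X"
  proof (rule injI)
    fix n n' assume "X n = X n'"
    then have "X n i = X n' i" by simp
    then show "n = n'" using i ai by (simp add: X_def)
  qed
  ultimately show False using finite_imageD infinite_UNIV_nat by blast
qed

section \<open>The gap principle for approximations to the surface\<close>

context totally_irrational_point
begin

text \<open>Write \<open>(a, b)\<close> for the point above \<open>q\<close>. If it is off the surface, the nonzero integer
  \<open>N f(a) - N q ^ (s - 1) b\<close> bounds \<open>err q\<close> from below. If it is on the surface, consider
  \<open>w = q' a - q a'\<close>: either \<open>N f(w)\<close> is a nonzero multiple of \<open>q\<close>, or \<open>a\<close> and \<open>a'\<close> are proportional,
  and then the point above \<open>q'\<close> is off the surface, with the larger defect \<open>k' ^ (s - 1)\<close>.\<close>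

lemma form_gap:
  fixes N :: int
  assumes m: "m = Suc d" and s: "2 \<le> s" and N: "0 < N"
    and form: "of_int N * \<theta> d = int_form d s C \<theta>"
    and aniso: "\<forall>a::nat \<Rightarrow> int. int_form d s C a = 0 \<longrightarrow> (\<forall>i<d. a i = 0)"
  shows "\<exists>c>0. c \<le> 1 \<and> (\<forall>q' q. 1 \<le> q' \<and> q' < q \<and> err q < err q' \<longrightarrow>
      c \<le> err q * real q ^ (s - 1) \<or> c \<le> err q' ^ s * real q ^ (s - 1))"
proof -
  obtain K where K: "0 \<le> K" and lip: "\<And>x \<delta>. 0 \<le> \<delta> \<Longrightarrow> \<delta> \<le> 1 \<Longrightarrow>
      (\<And>i. i < d \<Longrightarrow> \<bar>x i - \<theta> i\<bar> \<le> \<delta>) \<Longrightarrow> \<bar>int_form d s C x - int_form d s C \<theta>\<bar> \<le> K * \<delta>"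
    using lipschitz_near_int_form[of d \<theta> s C] unfolding lipschitz_near_def by metis
  define B where "B = (\<Sum>e\<in>multi_indices d s. \<bar>real_of_int (C e)\<bar>)"
  have B: "0 \<le> B" unfolding B_def by (intro sum_nonneg) auto
  define A where "A = (\<lambda>n j. round (real n * \<theta> j))"
  obtain s1 where s1: "s = Suc s1" "1 \<le> s1" using s by (cases s) auto
  \<comment> \<open>\<open>M\<close> dominates both \<open>K + N\<close>, from the distance to the
    surface, and \<open>B\<close>, from the size of the form; \<open>2 ^ s\<close> covers the powers
    of 2 arising from \<open>cross\<close>. One constant \<open>c\<close> then serves all
    cases.\<close>
  define M where "M = K + real_of_int N + B"
  have M: "1 \<le> M" using K B N by (simp add: M_def)
  define c where "c = 1 / (2 ^ s * M)"
  have c: "0 < c" "c \<le> 1"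
    using M one_le_power[of "2::real" s] mult_mono[of 1 "2 ^ s" 1 M] by (auto simp: c_def)
  have c_le: "c \<le> X" if "1 \<le> Z * X" "Z \<le> 2 ^ s * M" "0 \<le> X" for X Z
  proof -
    have "1 \<le> (2 ^ s * M) * X" using that mult_right_mono[of Z "2 ^ s * M" X] by linarith
    then show ?thesis using M by (simp add: c_def field_simps)
  qed
  have pow2: "1 \<le> (2::real) ^ s" by simp
  have KN: "K + real_of_int N \<le> M" using B by (simp add: M_def)
  \<comment> \<open>The defect of the point above \<open>n\<close> from the surface. The point
    \<open>A n / n\<close> is within \<open>err n / n\<close> of \<open>\<theta>\<close>;
    multiplying the Lipschitz bound by \<open>n ^ s\<close> gives the part with \<open>K\<close>,
    and rounding \<open>n * \<theta> d\<close> gives the part with \<open>N\<close>.\<close>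
  have near: "\<bar>real_of_int (int_form d s C (A n) - N * int n ^ s1 * A n d)\<bar>
      \<le> (K + real_of_int N) * real n ^ s1 * err n" if n: "1 \<le> n" for n
  proof -
    have n0: "0 < real n" using n by simp
    have en: "\<bar>real n * \<theta> j - real_of_int (A n j)\<bar> \<le> err n" if "j \<le> d" for j
      using abs_le_err[of j n] that m by (simp add: A_def)
    have "err n / real n \<le> err n"
      using divide_left_mono[of 1 "real n" "err n"] n err_nonneg[of n] by simp
    then have le1: "err n / real n \<le> 1" using err_le_half[of n] by simp
    have "\<bar>real_of_int (A n i) / real n - \<theta> i\<bar> \<le> err n / real n" if "i < d" for i
    proof -
      have "real_of_int (A n i) / real n - \<theta> i = - (real n * \<theta> i - real_of_int (A n i)) / real n"
        using n0 by (simp add: field_simps)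
      then have "\<bar>real_of_int (A n i) / real n - \<theta> i\<bar> = \<bar>real n * \<theta> i - real_of_int (A n i)\<bar> / real n"
        by (simp only: abs_divide abs_minus_cancel abs_of_nat)
      then show ?thesis using en[of i] that n0 by (simp add: divide_right_mono)
    qed
    then have "\<bar>int_form d s C (\<lambda>i. real_of_int (A n i) / real n) - int_form d s C \<theta>\<bar> \<le> K * (err n / real n)"
      using le1 err_nonneg by (intro lip) auto
    then have "real n ^ s * \<bar>int_form d s C (\<lambda>i. real_of_int (A n i) / real n) - int_form d s C \<theta>\<bar>
        \<le> real n ^ s * (K * (err n / real n))"
      by (intro mult_left_mono) auto
    also have "\<dots> = K * real n ^ s1 * err n" using n0 by (simp add: s1)
    also have "real n ^ s * \<bar>int_form d s C (\<lambda>i. real_of_int (A n i) / real n) - int_form d s C \<theta>\<bar>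
        = \<bar>real n ^ s * int_form d s C (\<lambda>i. real_of_int (A n i) / real n) - real n ^ s * int_form d s C \<theta>\<bar>"
      by (simp add: abs_mult right_diff_distrib[symmetric])
    also have "real n ^ s * int_form d s C (\<lambda>i. real_of_int (A n i) / real n) = real_of_int (int_form d s C (A n))"
      using n0 by (simp add: int_form_scale[symmetric] of_int_int_form)
    finally have 1: "\<bar>real_of_int (int_form d s C (A n)) - real n ^ s * int_form d s C \<theta>\<bar>
        \<le> K * real n ^ s1 * err n" .
    have "real n ^ s * int_form d s C \<theta> - real_of_int (N * int n ^ s1 * A n d)
        = real_of_int N * real n ^ s1 * (real n * \<theta> d - real_of_int (A n d))"
      unfolding form[symmetric] by (simp add: s1 algebra_simps)
    then have "\<bar>real n ^ s * int_form d s C \<theta> - real_of_int (N * int n ^ s1 * A n d)\<bar>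
        \<le> real_of_int N * real n ^ s1 * err n"
      using en[of d] N by (simp add: abs_mult mult_left_mono)
    with 1 show ?thesis by (simp add: algebra_simps)
  qed
  have "c \<le> err q * real q ^ s1 \<or> c \<le> err q' ^ s * real q ^ s1"
    if q': "1 \<le> q'" and qq: "q' < q" and less: "err q < err q'" for q q'
  proof (cases "int_form d s C (A q) = N * int q ^ s1 * A q d")
    case False
    then have "1 \<le> \<bar>int_form d s C (A q) - N * int q ^ s1 * A q d\<bar>" by simp
    then have "1 \<le> \<bar>real_of_int (int_form d s C (A q) - N * int q ^ s1 * A q d)\<bar>"
      by linarith
    also have "\<dots> \<le> (K + real_of_int N) * real q ^ s1 * err q"
      using qq by (intro near) simp
    finally have "1 \<le> (K + real_of_int N) * (err q * real q ^ s1)" by (simp add: mult_ac)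
    moreover have "K + real_of_int N \<le> 2 ^ s * M"
      using KN M pow2 mult_right_mono[of 1 "2 ^ s" M] by linarith
    ultimately have "c \<le> err q * real q ^ s1" using err_nonneg by (intro c_le) auto
    then show ?thesis by blast
  next
    case on: True
    have err0: "0 \<le> err q'" by (rule err_nonneg)
    have q0: "0 < q" using q' qq by simp
    \<comment> \<open>Eliminating \<open>\<theta> j\<close> between the two approximations leaves
      two rounding errors, and the one weighted by \<open>q\<close> dominates.\<close>
    have cross: "\<bar>real_of_int (int q' * A q j - int q * A q' j)\<bar> \<le> 2 * real q * err q'"
      if "j \<le> d" for j
    proof -
      have *: "\<bar>real n * \<theta> j - real_of_int (A n j)\<bar> \<le> err n" for n
        using abs_le_err[of j n] that m by (simp add: A_def)
      have "real_of_int (int q' * A q j - int q * A q' j)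
          = real q * (real q' * \<theta> j - real_of_int (A q' j)) - real q' * (real q * \<theta> j - real_of_int (A q j))"
        by (simp add: algebra_simps)
      also have "\<bar>\<dots>\<bar> \<le> \<bar>real q * (real q' * \<theta> j - real_of_int (A q' j))\<bar>
          + \<bar>real q' * (real q * \<theta> j - real_of_int (A q j))\<bar>" by (rule abs_triangle_ineq4)
      also have "\<dots> \<le> real q * err q' + real q' * err q"
        using * by (auto simp: abs_mult intro!: add_mono mult_left_mono)
      also have "\<dots> \<le> real q * err q' + real q * err q'"
        using qq less err_nonneg by (intro add_mono mult_mono) auto
      finally show ?thesis by simp
    qed
    have "c \<le> err q' ^ s * real q ^ s1"
    proof (cases "\<exists>i<d. int q' * A q i - int q * A q' i \<noteq> 0")
      case True
      define w where "w = (\<lambda>i. int q' * A q i - int q * A q' i)"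
      have "int_form d s C w \<noteq> 0" using aniso[rule_format, of w] True by (auto simp: w_def)
      \<comment> \<open>Modulo \<open>q\<close> the vector \<open>w\<close> is \<open>q'\<close>
        times the point above \<open>q\<close>, whose form value is divisible by \<open>q\<close>
        because the point is on the surface and \<open>s - 1 \<ge> 1\<close>.\<close>
      have "[int_form d s C w = int_form d s C (\<lambda>i. int q' * A q i)] (mod int q)"
        by (intro int_form_cong_mod) (simp add: w_def cong_iff_dvd_diff)
      also have "int_form d s C (\<lambda>i. int q' * A q i) = int q' ^ s * (N * int q ^ s1 * A q d)"
        by (simp add: int_form_scale on)
      finally have "[int_form d s C w = int q' ^ s * (N * int q ^ s1 * A q d)] (mod int q)" .
      moreover have "int q dvd int q' ^ s * (N * int q ^ s1 * A q d)"
        using s1(2) by (simp add: dvd_power)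
      ultimately have "int q dvd int_form d s C w" by (simp add: cong_dvd_iff)
      from dvd_imp_le_int[OF \<open>int_form d s C w \<noteq> 0\<close> this]
      have "int q \<le> \<bar>int_form d s C w\<bar>" by simp
      then have "real q \<le> \<bar>real_of_int (int_form d s C w)\<bar>" by linarith
      also have "\<dots> \<le> B * (2 * real q * err q') ^ s"
        unfolding of_int_int_form B_def using cross
        by (intro abs_int_form_le) (simp add: w_def)
      also have "\<dots> = real q * ((B * 2 ^ s) * (err q' ^ s * real q ^ s1))"
        by (simp add: s1 power_mult_distrib mult_ac)
      finally have "1 \<le> (B * 2 ^ s) * (err q' ^ s * real q ^ s1)"
        using q0 mult_le_cancel_left_pos[of "real q" 1] by simp
      moreover have "B * 2 ^ s \<le> 2 ^ s * M" using K N by (simp add: M_def)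
      ultimately show ?thesis using err0 by (intro c_le) auto
    next
      case False
      have "gcd q q' \<noteq> 0" using q0 by simp
      \<comment> \<open>With the common factor \<open>g\<close> of \<open>q\<close> and
        \<open>q'\<close> removed, proportionality and coprimality give one integer vector
        \<open>v\<close> with first \<open>d\<close> numerators \<open>k * v\<close> at
        \<open>q\<close> and \<open>k' * v\<close> at \<open>q'\<close>.\<close>
      from gcd_coprime_exists[OF this] obtain k k'
        where kk': "q = k * gcd q q' \<and> q' = k' * gcd q q' \<and> coprime k k'"
        by (elim exE)
      define g where "g = gcd q q'"
      have q_def: "q = k * g" and q'_def: "q' = k' * g" and coprime: "coprime k k'"
        using kk'[folded g_def] by (iprover)+
      have "0 < k * g" "0 < k' * g" using q0 q' unfolding q_def q'_def by simp_all
      then have pos: "0 < k" "0 < k'" "0 < g" by simp_all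
      define v where "v = (\<lambda>i. A q i div int k)"
      have proportional: "int k' * A q i = int k * A q' i" if "i < d" for i
      proof -
        have "int g * (int k' * A q i) = int g * (int k * A q' i)"
          using False that by (simp add: q_def q'_def mult_ac)
        then show ?thesis using pos by simp
      qed
      have v: "A q i = int k * v i" "A q' i = int k' * v i" if "i < d" for i
      proof -
        have "int k dvd int k' * A q i" using proportional[OF that] by simp
        then have "int k dvd A q i"
          using coprime by (simp add: coprime_dvd_mult_right_iff)
        then show 1: "A q i = int k * v i" by (simp add: v_def)
        have "int k * A q' i = int k * (int k' * v i)"
          unfolding proportional[OF that, symmetric] 1 by (rule mult.left_commute)
        moreover have "int k \<noteq> 0" using pos(1) by simp
        ultimately show "A q' i = int k' * v i" by (simp only: mult_cancel_left simp_thms)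
      qed
      define b b' where "b = A q d" and "b' = A q' d"
      \<comment> \<open>If the last numerators were proportional too, all errors at
        \<open>q'\<close> would be \<open>k' / k < 1\<close> times those at \<open>q\<close>,
        contradicting \<open>err q < err q'\<close>.\<close>
      have ne: "int k' * b \<noteq> int k * b'"
      proof
        assume eq: "int k' * b = int k * b'"
        have "err q' \<le> err q"
        proof (rule err_le)
          fix j assume "j < m"
          then have "int k' * A q j = int k * A q' j"
            using eq proportional[of j] m by (cases "j = d") (auto simp: b_def b'_def)
          from arg_cong[OF this, of real_of_int]
          have "real k * real_of_int (A q' j) = real k' * real_of_int (A q j)"
            by simp
          then have "real k * (real q' * \<theta> j - real_of_int (A q' j))
              = real k' * (real q * \<theta> j - real_of_int (A q j))"
            by (simp add: q_def q'_def algebra_simps)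
          from arg_cong[OF this, of abs]
          have "real k * \<bar>real q' * \<theta> j - real_of_int (A q' j)\<bar>
              = real k' * \<bar>real q * \<theta> j - real_of_int (A q j)\<bar>"
            by (simp only: abs_mult abs_of_nat)
          also have "\<dots> \<le> real k' * err q"
            using abs_le_err[OF \<open>j < m\<close>, of q] by (intro mult_left_mono) (auto simp: A_def)
          also have "\<dots> \<le> real k * err q"
            using qq pos err_nonneg by (intro mult_right_mono) (auto simp: q_def q'_def)
          finally show "\<bar>real q' * \<theta> j - real_of_int (round (real q' * \<theta> j))\<bar> \<le> err q"
            using pos by (simp add: A_def)
        qed
        with less show False by simp
      qed
      \<comment> \<open>The nonzero integer \<open>k' * b - k * b'\<close>, multiplied by
        \<open>g\<close>, is the cross difference in coordinate \<open>d\<close>; hence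
        \<open>err q'\<close> is at least \<open>1 / (2 * k)\<close>.\<close>
      have "1 \<le> \<bar>int k' * b - int k * b'\<bar>" using ne by simp
      then have "real g * 1 \<le> real g * \<bar>real_of_int (int k' * b - int k * b')\<bar>"
        by (intro mult_left_mono) linarith+
      also have "\<dots> = \<bar>real_of_int (int q' * A q d - int q * A q' d)\<bar>"
      proof -
        have "real_of_int (int q' * A q d - int q * A q' d) = real g * real_of_int (int k' * b - int k * b')"
          by (simp add: q_def q'_def b_def b'_def algebra_simps)
        then show ?thesis by (simp add: abs_mult)
      qed
      also have "\<dots> \<le> real g * (2 * real k * err q')"
        using cross[of d] by (simp add: q_def mult_ac)
      finally have err1: "1 \<le> 2 * real k * err q'" using pos by simp
      define F where "F = int_form d s C v"
      have "int_form d s C (A q) = int_form d s C (\<lambda>i. int k * v i)"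
        by (intro int_form_cong v)
      then have "int k ^ s1 * (int k * F) = int k ^ s1 * (N * int g ^ s1 * b)"
        using on by (simp add: int_form_scale F_def b_def q_def power_mult_distrib s1 mult_ac)
      then have kF: "int k * F = N * int g ^ s1 * b" using pos by simp
      \<comment> \<open>The defect at \<open>q'\<close> without its factor \<open>k' ^ s1\<close>.
        The surface equation at \<open>q\<close> makes \<open>k * E\<close> a nonzero multiple of
        \<open>k' * b - k * b'\<close>, so \<open>E\<close> is a nonzero integer.\<close>
      define E where "E = int k' * F - N * int g ^ s1 * b'"
      have "int k * E = N * int g ^ s1 * (int k' * b - int k * b')"
      proof -
        have "int k * E = int k' * (int k * F) - int k * (N * int g ^ s1 * b')"
          by (simp add: E_def algebra_simps)
        then show ?thesis unfolding kF by (simp only: algebra_simps)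
      qed
      then have "E \<noteq> 0" using ne N pos by auto
      have "int_form d s C (A q') = int_form d s C (\<lambda>i. int k' * v i)"
        by (intro int_form_cong v)
      also have "\<dots> = int k' ^ s1 * (int k' * F)"
        by (simp add: int_form_scale F_def s1)
      finally have F': "int_form d s C (A q') = int k' ^ s1 * (int k' * F)" .
      have "int q' ^ s1 = int k' ^ s1 * int g ^ s1"
        by (simp add: q'_def power_mult_distrib)
      then have eqE: "int_form d s C (A q') - N * int q' ^ s1 * A q' d = int k' ^ s1 * E"
        unfolding F' E_def b'_def by (simp add: algebra_simps)
      have "1 \<le> \<bar>real_of_int E\<bar>" using \<open>E \<noteq> 0\<close> by linarith
      then have "real k' ^ s1 * 1 \<le> real k' ^ s1 * \<bar>real_of_int E\<bar>"
        by (intro mult_left_mono) auto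
      also have "\<dots> = \<bar>real_of_int (int k' ^ s1 * E)\<bar>" by (simp add: abs_mult)
      also have "\<dots> \<le> (K + real_of_int N) * real q' ^ s1 * err q'"
        using near[OF q'] unfolding eqE .
      also have "\<dots> = real k' ^ s1 * ((K + real_of_int N) * real g ^ s1 * err q')"
        by (simp add: q'_def power_mult_distrib mult_ac)
      finally have err2: "1 \<le> (K + real_of_int N) * real g ^ s1 * err q'"
        using pos by simp
      \<comment> \<open>Taking \<open>err1\<close> to the power \<open>s1\<close> and
        \<open>err2\<close> once collects \<open>err q' ^ s\<close> and \<open>(k * g) ^ s1\<close>,
        which is \<open>q ^ s1\<close>.\<close>
      have "1 * 1 \<le> (2 * real k * err q') ^ s1 * ((K + real_of_int N) * real g ^ s1 * err q')"
        using err2 one_le_power[OF err1, of s1] by (intro mult_mono) auto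
      also have "\<dots> = (2 ^ s1 * (K + real_of_int N)) * (err q' ^ s * real q ^ s1)"
        by (simp add: q_def s1 power_mult_distrib mult_ac)
      finally have "1 \<le> (2 ^ s1 * (K + real_of_int N)) * (err q' ^ s * real q ^ s1)" by simp
      moreover have "2 ^ s1 * (K + real_of_int N) \<le> 2 ^ s * M"
        using KN K N by (intro mult_mono) (auto simp: s1)
      ultimately show ?thesis using err0 by (intro c_le) auto
    qed
    then show ?thesis by blast
  qed
  then show ?thesis using c s1 by auto
qed

end

section \<open>The uniform exponent\<close>

context totally_irrational_point
begin

text \<open>Nearest integers are at least as good as any \<open>a j\<close>, and
  \<open>best Q\<close> is at least as good as any other denominator up to \<open>Q\<close>.\<close>

lemma err_best_less_if_solvable:
  assumes sol: "uniform_system_solvable m \<theta> \<gamma> (real Q)" and Q: "1 \<le> Q"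
  shows "err (best Q) < real Q powr (- \<gamma>)"
proof -
  obtain q a where q: "1 \<le> q" "real_of_int q \<le> real Q"
    and lt: "(MAX j\<in>{..<m}. \<bar>real_of_int q * \<theta> j - real_of_int (a j)\<bar>) < real Q powr (- \<gamma>)"
    using sol unfolding uniform_system_solvable_def by blast
  define r where "r = nat q"
  have r: "1 \<le> r" "r \<le> Q" "real r = real_of_int q"
    using q by (auto simp: r_def)
  have "err r \<le> (MAX j\<in>{..<m}. \<bar>real_of_int q * \<theta> j - real_of_int (a j)\<bar>)"
  proof (rule err_le)
    fix j assume "j < m"
    have "\<bar>real r * \<theta> j - real_of_int (round (real r * \<theta> j))\<bar> \<le> \<bar>real_of_int q * \<theta> j - real_of_int (a j)\<bar>"
      unfolding r(3) by (rule round_diff_minimal)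
    also have "\<dots> \<le> (MAX j\<in>{..<m}. \<bar>real_of_int q * \<theta> j - real_of_int (a j)\<bar>)"
      using \<open>j < m\<close> by (intro Max_ge) auto
    finally show "\<bar>real r * \<theta> j - real_of_int (round (real r * \<theta> j))\<bar> \<le> \<dots>" .
  qed
  with err_best_le[OF Q r(1,2)] lt show ?thesis by linarith
qed

text \<open>The strict inequality \<open>H < \<gamma>\<close> leaves a negative power of
  \<open>Q\<close>, which absorbs \<open>\<epsilon>\<close> and the factor \<open>2 powr H\<close>
  from \<open>Suc Q \<le> 2 * Q\<close>.\<close>

lemma err_best_small_if_solvable:
  assumes sol: "eventually (uniform_system_solvable m \<theta> \<gamma>) at_top"
    and H: "0 < H" "H < \<gamma>" and \<epsilon>: "0 < \<epsilon>"
  shows "\<forall>\<^sub>F Q in sequentially. err (best Q) * real (Suc Q) powr H \<le> \<epsilon>"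
proof -
  have "\<forall>\<^sub>F Q in sequentially. uniform_system_solvable m \<theta> \<gamma> (real Q)"
    using sol filterlim_real_sequentially by (rule eventually_compose_filterlim)
  moreover have "(\<lambda>Q. 2 powr H * real Q powr (H - \<gamma>)) \<longlonglongrightarrow> 2 powr H * 0"
    using H by (intro tendsto_mult tendsto_const tendsto_neg_powr filterlim_real_sequentially) simp
  then have "\<forall>\<^sub>F Q in sequentially. 2 powr H * real Q powr (H - \<gamma>) < \<epsilon>"
    using \<epsilon> by (intro order_tendstoD) auto
  moreover have "\<forall>\<^sub>F Q in sequentially. 1 \<le> Q" by (rule eventually_ge_at_top)
  ultimately show ?thesis
  proof eventually_elim
    case (elim Q)
    have "err (best Q) * real (Suc Q) powr H \<le> real Q powr (- \<gamma>) * (2 * real Q) powr H"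
      using err_best_less_if_solvable[OF elim(1,3)] elim(3) H(1) err_nonneg
      by (intro mult_mono powr_mono2) auto
    also have "\<dots> = 2 powr H * real Q powr (H - \<gamma>)"
      by (simp add: powr_mult powr_add[symmetric])
    also have "\<dots> \<le> \<epsilon>" using elim(2) by simp
    finally show ?case .
  qed
qed

end

section \<open>The root as a balance of exponents, and the conclusion\<close>

text \<open>Moving \<open>x\<close> to the right in the defining equation supplies the term
  \<open>j = 0\<close> of a geometric sum in \<open>t = H / (s - 1)\<close>. Multiplied by
  \<open>1 - t\<close> it reads \<open>1 - t = H * (1 - t ^ Suc d)\<close>, which is at most
  \<open>H\<close>; clearing denominators gives the last inequality.\<close>

lemma H_root_props:
  assumes s: "2 \<le> s"
  shows H_root_pos: "0 < H_root d s"
    and H_root_sum: "H_root d s * (\<Sum>j<Suc d. (H_root d s / (real s - 1)) ^ j) = 1"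
    and H_root_ge: "real s - 1 \<le> real s * H_root d s"
proof -
  define H where "H = H_root d s"
  define t where "t = H / (real s - 1)"
  have H: "0 < H" "1 - H = H * (\<Sum>k=1..d. t ^ k)"
    using theI'[OF H_root_unique[OF s, of d]] unfolding t_def H_def H_root_def by blast+
  have s1: "0 < real s - 1" using s by simp
  have t: "0 < t" using H s1 by (simp add: t_def)
  have "(\<Sum>j<Suc d. t ^ j) = 1 + (\<Sum>k=1..d. t ^ k)"
    by (simp add: sum.lessThan_Suc_shift sum.atLeast1_atMost_eq del: sum.lessThan_Suc)
  then have sum: "H * (\<Sum>j<Suc d. t ^ j) = 1"
    using H(2) by (simp add: distrib_left)
  have "1 - t = H * ((1 - t) * (\<Sum>j<Suc d. t ^ j))"
    using sum by (metis mult.commute mult.left_commute mult.right_neutral)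
  also have "\<dots> = H * (1 - t ^ Suc d)" by (simp only: one_diff_power_eq)
  also have "\<dots> \<le> H" using H(1) t by (simp add: mult_left_le)
  finally have "real s - 1 \<le> real s * H" using s1 by (simp add: t_def field_simps)
  with H(1) sum show "0 < H_root d s"
    and "H_root d s * (\<Sum>j<Suc d. (H_root d s / (real s - 1)) ^ j) = 1"
    and "real s - 1 \<le> real s * H_root d s"
    by (simp_all only: t_def H_def)
qed

theorem mainTheorem4:
  fixes s d :: nat
    and c :: "(nat \<Rightarrow> nat) \<Rightarrow> rat"
    and \<xi> :: "nat \<Rightarrow> real"
  assumes "s \<ge> 2" and "d \<ge> 1"
    and "finite {x \<in> {..<d} \<rightarrow>\<^sub>E (UNIV :: rat set). form_eval d s c x = 0}"
    and "totally_irrational (d + 1) (\<xi>(d := form_eval d s c \<xi>))"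
  shows "uniform_exponent (d + 1) (\<xi>(d := form_eval d s c \<xi>)) \<le> ereal (H_root d s)"
proof -
  define \<theta> where "\<theta> = \<xi>(d := form_eval d s c \<xi>)"
  interpret totally_irrational_point "d + 1" \<theta>
    using assms(4) by unfold_locales (simp_all add: \<theta>_def)
  obtain N C where N: "(0::int) < N"
    and C: "\<And>e. e \<in> multi_indices d s \<Longrightarrow> of_int N * c e = of_int (C e)"
    using ex_common_denominator[OF finite_multi_indices, of d s c] by blast
  \<comment> \<open>The form reads only the coordinates below \<open>d\<close>, where
    \<open>\<theta>\<close> and \<open>\<xi>\<close> agree.\<close>
  have "int_form d s C \<theta> = int_form d s C \<xi>"
    by (intro int_form_cong) (simp add: \<theta>_def)
  also have "\<dots> = of_int N * \<theta> d"
    using int_form_eq_form_eval[OF C, where x = \<xi>] by (simp add: \<theta>_def)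
  finally have form: "of_int N * \<theta> d = int_form d s C \<theta>" by simp
  have aniso: "\<forall>a::nat \<Rightarrow> int. int_form d s C a = 0 \<longrightarrow> (\<forall>i<d. a i = 0)"
    using form_zero_int_imp_zero[OF assms(3) C N] by blast
  obtain \<kappa> where \<kappa>: "0 < \<kappa>" "\<kappa> \<le> 1" and gap: "\<And>q' q. \<lbrakk>1 \<le> q'; q' < q; err q < err q'\<rbrakk> \<Longrightarrow>
      \<kappa> \<le> err q * real q ^ (s - 1) \<or> \<kappa> \<le> err q' ^ s * real q ^ (s - 1)"
    using form_gap[OF _ assms(1) N form aniso] by auto
  note H = H_root_props[OF assms(1), of d]
  \<comment> \<open>An admissible exponent above the root would supply the arbitrarily small
    constants of the determinant argument at \<open>H = H_root d s\<close>, with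
    \<open>d + 1\<close> in place of \<open>m\<close>.\<close>
  have "\<gamma> \<le> H_root d s" if sol: "eventually (uniform_system_solvable (d + 1) \<theta> \<gamma>) at_top" for \<gamma>
  proof (rule ccontr)
    assume "\<not> \<gamma> \<le> H_root d s"
    then have "H_root d s < \<gamma>" by simp
    from uniform_approximation_contradiction[OF assms(1) H(1,3) refl _ \<kappa> gap
        err_best_small_if_solvable[OF sol H(1) this]]
    show False using H(2) by simp
  qed
  then show ?thesis
    unfolding uniform_exponent_def \<theta>_def[symmetric] by (intro Sup_least) auto
qed

end
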